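(* Let $n,m\ge0$ be integers with $n+m\ge1$, $p\in\mathbb C$, and let $\rho:U_q[sl(n+1|m)]\to W(n|m)$ be the Dyson realization, i.e. the algebra homomorphism determined by $\rho(H_i)=p-(-1)^{\theta_i}N_i-N$, $\rho(a_i^-)=q^{N_1+\cdots+N_{i-1}}\frac{[N_i+1]}{N_i+1}[p-N]c_i^-$, $\rho(a_i^+)=\bar q^{\,N_1+\cdots+N_{i-1}}c_i^+$ for $i\in[1;n+m]$. Then the remaining Cartan-Weyl elements $e_{ji}$, $i\ne j\in[1;n+m]$, are realized as $$\rho(e_{ji})=q^{2\theta_j(N_j-1)+N_{j+1}+N_{j+2}+\cdots+N_{i-1}}\,\frac{[N_i+1]}{N_i+1}\,c_j^+c_i^-\qquad(j<i),$$ $$\rho(e_{ji})=\bar q^{\,2\theta_iN_i+N_{i+1}+N_{i+2}+\cdots+N_{j-1}}\,\frac{[N_i+1]}{N_i+1}\,c_j^+c_i^-\qquad(j>i),$$ where the sum $N_{j+1}+\cdots+N_{i-1}$ is $0$ when $j=i-1$, and $N_{i+1}+\cdots+N_{j-1}$ is $0$ when $i=j-1$.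
   Context: Notation: $h$ is an indeterminate, $q=e^h$, $\bar q=q^{-1}$, $[x]=\frac{q^x-q^{-x}}{q-q^{-1}}$; $[r;s]=\{r,\dots,s\}$; $\theta_i=0$ for $i\in[0;n]$, $\theta_i=1$ for $i\in[n+1;n+m]$ (integers where needed). For homogeneous $a,b$ in a superalgebra, $[\![a,b]\!]=ab-(-1)^{\deg(a)\deg(b)}ba$. $U_q[sl(n+1|m)]$ is the quantum superalgebra over $\mathbb C[[h]]$ (for the distinguished simple root system) with Cartan-Weyl elements $H_i$ ($i\in[1;n+m]$) and $e_{ij}$ ($i\neq j\in[0;n+m]$, $\deg e_{ij}=\theta_i+\theta_j$). Put $L_i=q^{H_i}$, $\bar L_i=q^{-H_i}$. It is generated by the Jacobson generators $H_i$, $a_i^-=e_{0i}$, $a_i^+=e_{i0}$ ($i\in[1;n+m]$), and the remaining Cartan-Weyl elements $e_{ji}$ ($i\ne j\in[1;n+m]$) are determined by $$[\![a_i^-,a_j^+]\!]=-(-1)^{\theta_i}L_ie_{ji}\ (i<j),\qquad[\![a_i^-,a_j^+]\!]=-(-1)^{\theta_j}e_{ji}\bar L_j\ (i>j).$$ $W(n|m)$ is the ($h$-adically completed) associative superalgebra over $\mathbb C[[h]]$ generated by $c_i^\pm$ ($i\in[1;n+m]$), $\deg(c_i^\pm)=\theta_i$, with relations $[\![c_i^-,c_j^+]\!]=\delta_{ij}$, $[\![c_i^+,c_j^+]\!]=[\![c_i^-,c_j^-]\!]=0$. $N_i=c_i^+c_i^-$, $N=\sum_{j=1}^{n+m}N_j$.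 Functions of the commuting $N_i$ are power series in $h$ with coefficients polynomial in the $N_i$ (note $\frac{[x]}{x}=\frac{\sinh(hx)}{x\sinh h}\in\mathbb C[x][[h]]$). *)

theory Defs
  imports
    "HOL-Library.Poly_Mapping"
    "HOL-Computational_Algebra.Polynomial"
    "HOL-Computational_Algebra.Formal_Power_Series"
    "HOL-Algebra.QuotRing"
begin

section \<open>Complete algebras over \<open>\<complex>[[h]]\<close> given by generators and relations\<close>

datatype 'g word = Word (letters: "'g list")

instantiation word :: (type) monoid_add
begin

definition zero_word :: "'a word" where "0 = Word []"
definition plus_word :: "'a word \<Rightarrow> 'a word \<Rightarrow> 'a word" where
  "u + v = Word (letters u @ letters v)"

instance
  by standard (auto simp: zero_word_def plus_word_def)

end

text \<open>
  The monoid algebra \<open>'g word \<Rightarrow>\<^sub>0 complex\<close> is the free algebra \<open>\<complex>\<langle>'g\<rangle>\<close>, and power series in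
  \<open>h = fps_X\<close> over it form the \<open>h\<close>-adic completion of the free \<open>\<complex>[[h]]\<close>-algebra. The topology of
  the library on \<open>fps\<close> is the \<open>h\<close>-adic one.
\<close>
type_synonym 'g halg = "('g word \<Rightarrow>\<^sub>0 complex) fps"

definition gen :: "'g \<Rightarrow> 'g halg" where
  "gen g = fps_const (Poly_Mapping.single (Word [g]) 1)"

definition scal :: "complex fps \<Rightarrow> 'g halg" where
  "scal s = Abs_fps (\<lambda>k. Poly_Mapping.single 0 (fps_nth s k))"

definition const :: "complex \<Rightarrow> 'g halg" where
  "const a = scal (fps_const a)"

definition hfree :: "'g set \<Rightarrow> 'g halg ring" where
  "hfree X = \<lparr>carrier = {a. \<forall>k. \<forall>w \<in> Poly_Mapping.keys (fps_nth a k). set (letters w) \<subseteq> X},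
              mult = (*), one = 1, zero = 0, add = (+)\<rparr>"

lemma ring_hfree: "ring (hfree X)"
proof (rule ringI)
  show "abelian_group (hfree X)"
  proof (rule abelian_groupI)
    fix x y assume "x \<in> carrier (hfree X)" "y \<in> carrier (hfree X)"
    then show "x \<oplus>\<^bsub>hfree X\<^esub> y \<in> carrier (hfree X)"
      using keys_add by (fastforce simp: hfree_def)
  next
    fix x assume "x \<in> carrier (hfree X)"
    then show "\<exists>y\<in>carrier (hfree X). y \<oplus>\<^bsub>hfree X\<^esub> x = \<zero>\<^bsub>hfree X\<^esub>"
      by (intro bexI[of _ "- x"]) (auto simp: hfree_def keys_minus)
  qed (auto simp: hfree_def algebra_simps)
  show "Group.monoid (hfree X)"
  proof (rule monoidI)
    fix x y assume xy: "x \<in> carrier (hfree X)" "y \<in> carrier (hfree X)"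
    { fix k w assume "w \<in> Poly_Mapping.keys (fps_nth (x * y) k)"
      then obtain i where "w \<in> Poly_Mapping.keys (fps_nth x i * fps_nth y (k - i))"
        unfolding fps_mult_nth using keys_sum[of "\<lambda>i. fps_nth x i * fps_nth y (k - i)" "{0..k}"]
        by blast
      then obtain u v where "w = u + v" "u \<in> Poly_Mapping.keys (fps_nth x i)"
          "v \<in> Poly_Mapping.keys (fps_nth y (k - i))"
        using keys_mult by blast
      with xy have "set (letters w) \<subseteq> X"
        by (fastforce simp: hfree_def plus_word_def) }
    then show "x \<otimes>\<^bsub>hfree X\<^esub> y \<in> carrier (hfree X)"
      by (auto simp: hfree_def)
  next
    show "\<one>\<^bsub>hfree X\<^esub> \<in> carrier (hfree X)"
      by (auto simp: hfree_def fps_one_nth zero_word_def)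
  qed (auto simp: hfree_def mult.assoc)
qed (auto simp: hfree_def algebra_simps)

text \<open>
  In an \<open>h\<close>-adically complete presentation one divides by the closure of the ideal generated
  by the relators.
\<close>
definition hideal :: "'g set \<Rightarrow> 'g halg set \<Rightarrow> 'g halg set" where
  "hideal X S = \<Inter>{I. ideal I (hfree X) \<and> closed I \<and> S \<subseteq> I}"

definition halg :: "'g set \<Rightarrow> 'g halg set \<Rightarrow> 'g halg set ring" where
  "halg X S = hfree X Quot hideal X S"

definition hclass :: "'g set \<Rightarrow> 'g halg set \<Rightarrow> 'g halg \<Rightarrow> 'g halg set" where
  "hclass X S a = hideal X S +>\<^bsub>hfree X\<^esub> a"

text \<open>
  Homomorphisms of unital \<open>\<complex>[[h]]\<close>-algebras. Compatibility with the structure maps from \<open>\<complex>[[h]]\<close>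
  is \<open>\<complex>[[h]]\<close>-linearity; it implies \<open>h\<close>-adic continuity, which is therefore not required.
\<close>
definition halg_hom ::
    "'a set \<Rightarrow> 'a halg set \<Rightarrow> 'b set \<Rightarrow> 'b halg set \<Rightarrow> ('a halg set \<Rightarrow> 'b halg set) set" where
  "halg_hom X S Y T =
     {f \<in> ring_hom (halg X S) (halg Y T). \<forall>s. f (hclass X S (scal s)) = hclass Y T (scal s)}"

text \<open>The arguments \<open>d\<close>, \<open>d'\<close> are the degrees of the homogeneous elements \<open>a\<close>, \<open>b\<close>.\<close>
definition sbracket :: "('a, 'r) ring_scheme \<Rightarrow> nat \<Rightarrow> nat \<Rightarrow> 'a \<Rightarrow> 'a \<Rightarrow> 'a" where
  "sbracket R d d' a b =
     a \<otimes>\<^bsub>R\<^esub> b \<ominus>\<^bsub>R\<^esub> [((-1 :: int) ^ (d * d'))] \<cdot>\<^bsub>R\<^esub> (b \<otimes>\<^bsub>R\<^esub> a)"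


section \<open>Power series in \<open>h\<close> with polynomial coefficients\<close>

text \<open>\<open>pexp a\<close> is \<open>e\<^sup>h\<^sup>a\<close> in \<open>\<complex>[x][[h]]\<close>; the indeterminate \<open>x\<close> is \<open>[:0, 1:]\<close>.\<close>
definition pexp :: "complex poly \<Rightarrow> complex poly fps" where
  "pexp a = Abs_fps (\<lambda>k. smult (1 / fact k) (a ^ k))"

text \<open>\<open>qint\<close> is \<open>[x] = (q\<^sup>x - q\<^sup>-\<^sup>x) / (q - q\<^sup>-\<^sup>1)\<close> and \<open>qratio\<close> is \<open>[x] / x\<close>.\<close>
definition qint :: "complex poly fps" where
  "qint = (THE F. F * (pexp 1 - pexp (-1)) = pexp [:0, 1:] - pexp (- [:0, 1:]))"

definition qratio :: "complex poly fps" where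
  "qratio = (THE G. G * fps_const [:0, 1:] = qint)"

lemma qint_qratio:
  shows qint: "qint * (pexp 1 - pexp (-1)) = pexp [:0, 1:] - pexp (- [:0, 1:])"
    and qratio: "qratio * fps_const [:0, 1:] = qint"
proof -
  define emb :: "complex fps \<Rightarrow> complex poly fps" where "emb s = Abs_fps (\<lambda>k. [:fps_nth s k:])" for s
  have pc: "(\<Sum>i\<in>A. [:f i:]) = [:\<Sum>i\<in>A. f i:]" for f :: "nat \<Rightarrow> complex" and A :: "nat set"
    by (induction A rule: infinite_finite_induct) auto
  have emb: "emb s * emb t = emb (s * t)" for s t
    by (auto simp: emb_def fps_eq_iff fps_mult_nth pc mult.commute)
  define d :: "complex fps" where "d = Abs_fps (\<lambda>k. (1 - (-1) ^ (k+1)) / fact (k+1))"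
  define S :: "complex poly fps"
    where "S = Abs_fps (\<lambda>k. smult ((1 - (-1) ^ (k+1)) / fact (k+1)) ([:0, 1:] ^ k))"
  have d: "inverse d * d = 1" by (rule inverse_mult_eq_1) (simp add: d_def)
  have D: "pexp 1 - pexp (-1) = fps_X * emb d"
  proof (rule fps_ext)
    fix k show "fps_nth (pexp 1 - pexp (-1)) k = fps_nth (fps_X * emb d) k"
      by (cases k) (auto simp: pexp_def emb_def d_def diff_divide_distrib
           minus_one_power_iff)
  qed
  have E: "pexp [:0, 1:] - pexp (- [:0, 1:]) = fps_X * (S * fps_const [:0, 1:])"
  proof (rule fps_ext)
    fix k show "fps_nth (pexp [:0, 1:] - pexp (- [:0, 1:])) k
        = fps_nth (fps_X * (S * fps_const [:0, 1:])) k"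
    proof (cases k)
      case (Suc l)
      have "(- [:0, 1:]) ^ Suc l = smult ((-1) ^ Suc l) ([:0, 1 :: complex:] ^ Suc l)"
        by (metis mult_smult_left mult_1 smult_1_left smult_minus_left smult_power)
      moreover have "[:0, 1 :: complex:] ^ Suc l = pCons 0 ([:0, 1:] ^ l)" by simp
      ultimately show ?thesis
        by (simp add: Suc pexp_def S_def smult_diff_left[symmetric] diff_divide_distrib mult.commute
              del: power_Suc)
    qed (simp add: pexp_def)
  qed
  define G where "G = S * emb (inverse d)"
  have e1: "emb 1 = 1" by (auto simp: emb_def fps_eq_iff one_pCons fps_one_nth)
  have ne: "pexp 1 - pexp (-1) \<noteq> 0"
  proof
    assume "pexp 1 - pexp (-1) = 0"
    then have "fps_nth (pexp 1 - pexp (-1)) 1 = 0" by simp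
    then show False by (simp add: pexp_def one_pCons)
  qed
  have F: "(G * fps_const [:0, 1:]) * (pexp 1 - pexp (-1)) = pexp [:0, 1:] - pexp (- [:0, 1:])"
  proof -
    have "(G * fps_const [:0, 1:]) * (fps_X * emb d)
        = fps_X * (S * fps_const [:0,1:]) * (emb (inverse d) * emb d)"
      unfolding G_def by (simp only: mult_ac)
    then show ?thesis unfolding D E by (simp add: emb d e1)
  qed
  have q: "qint = G * fps_const [:0, 1:]"
    unfolding qint_def
    using F by (rule the_equality) (metis F ne mult_right_cancel)
  then show "qint * (pexp 1 - pexp (-1)) = pexp [:0, 1:] - pexp (- [:0, 1:])"
    using F by simp
  have "qratio = G"
    unfolding qratio_def
  proof (rule the_equality)
    fix G' assume "G' * fps_const [:0, 1:] = qint"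
    then show "G' = G" using q mult_right_cancel[of "fps_const [:0, 1 :: complex:]" G' G] by simp
  qed (use q in simp)
  then show "qratio * fps_const [:0, 1:] = qint" using q by simp
qed

definition poly_at :: "complex poly \<Rightarrow> 'g halg \<Rightarrow> 'g halg" where
  "poly_at P a = (\<Sum>i\<le>degree P. const (coeff P i) * a ^ i)"

definition series_at :: "complex poly fps \<Rightarrow> 'g halg \<Rightarrow> 'g halg" where
  "series_at F a = suminf (\<lambda>k. fps_X ^ k * poly_at (fps_nth F k) a)"

lemma sums_fps_X_power:
  fixes g :: "nat \<Rightarrow> 'a::ring_1 fps"
  shows "(\<lambda>k. fps_X ^ k * g k) sums Abs_fps (\<lambda>k. \<Sum>i\<le>k. fps_nth (g i) (k - i))"
  unfolding sums_def tendsto_fps_iff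
proof
  fix k
  have "eventually (\<lambda>n. fps_nth (\<Sum>i<n. fps_X ^ i * g i) k
          = fps_nth (Abs_fps (\<lambda>k. \<Sum>i\<le>k. fps_nth (g i) (k - i))) k) sequentially"
    unfolding eventually_sequentially
  proof (intro exI[of _ "Suc k"] allI impI)
    fix n assume n: "Suc k \<le> n"
    have "fps_nth (\<Sum>i<n. fps_X ^ i * g i) k = (\<Sum>i<n. if k < i then 0 else fps_nth (g i) (k - i))"
      by (simp add: fps_sum_nth fps_X_power_mult_nth)
    also have "\<dots> = (\<Sum>i\<le>k. fps_nth (g i) (k - i))"
      using n by (intro sum.mono_neutral_cong_right) auto
    finally show "fps_nth (\<Sum>i<n. fps_X ^ i * g i) k
          = fps_nth (Abs_fps (\<lambda>k. \<Sum>i\<le>k. fps_nth (g i) (k - i))) k" by simp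
  qed
  then show "eventually (\<lambda>n. fps_nth (\<Sum>i<n. fps_X ^ i * g i) k
          = fps_nth (Abs_fps (\<lambda>k. \<Sum>i\<le>k. fps_nth (g i) (k - i))) k) sequentially" .
qed

lemma series_at_nth:
  "fps_nth (series_at F a) k = (\<Sum>i\<le>k. fps_nth (poly_at (fps_nth F i) a) (k - i))"
  unfolding series_at_def by (subst sums_unique[OF sums_fps_X_power, symmetric]) simp

abbreviation qpow :: "'g halg \<Rightarrow> 'g halg" where
  "qpow a \<equiv> series_at (pexp [:0, 1:]) a"

abbreviation qbrk :: "'g halg \<Rightarrow> 'g halg" where
  "qbrk a \<equiv> series_at qint a"

abbreviation qbrk_ratio :: "'g halg \<Rightarrow> 'g halg" where
  "qbrk_ratio a \<equiv> series_at qratio a"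

definition qcomm :: "int \<Rightarrow> 'g halg \<Rightarrow> 'g halg \<Rightarrow> 'g halg" where
  "qcomm s a b = a * b - qpow (of_int s) * b * a"


section \<open>The quantum superalgebra \<open>U\<^sub>q[sl(n+1|m)]\<close>\<close>

definition theta :: "nat \<Rightarrow> nat \<Rightarrow> nat" where
  "theta n i = (if i \<le> n then 0 else 1)"

text \<open>Chevalley generators \<open>h\<^sub>i\<close>, \<open>e\<^sub>i\<close>, \<open>f\<^sub>i\<close> for the distinguished simple root system.\<close>
datatype chevalley = ChH nat | ChE nat | ChF nat

definition U_gens :: "nat \<Rightarrow> nat \<Rightarrow> chevalley set" where
  "U_gens n m = ChH ` {1..n+m} \<union> ChE ` {1..n+m} \<union> ChF ` {1..n+m}"

text \<open>The degree of \<open>e\<^sub>i\<close> and \<open>f\<^sub>i\<close>: only the simple root number \<open>n + 1\<close> is odd.\<close>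
definition chdeg :: "nat \<Rightarrow> nat \<Rightarrow> nat" where
  "chdeg n i = theta n (i - 1) + theta n i"

definition cartan :: "nat \<Rightarrow> nat \<Rightarrow> nat \<Rightarrow> int" where
  "cartan n i j = (if i = j then 1 + (-1) ^ chdeg n i
                   else if j = i + 1 then - ((-1) ^ chdeg n i)
                   else if i = j + 1 then -1 else 0)"

text \<open>
  Cartan--Kac relations, then the Serre relations, which are the same for the \<open>e\<^sub>i\<close> and the
  \<open>f\<^sub>i\<close>. The relation for \<open>cartan n i j = 0\<close> contains \<open>e\<^sub>n\<^sub>+\<^sub>1\<^sup>2 = 0\<close>; the last one is the additional
  Serre relation at the odd simple root.
\<close>
definition U_rels :: "nat \<Rightarrow> nat \<Rightarrow> chevalley halg set" where
  "U_rels n m = (let I = {1..n+m}; R = hfree (U_gens n m);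
      h = (\<lambda>i. gen (ChH i)); e = (\<lambda>i. gen (ChE i)); f = (\<lambda>i. gen (ChF i)) in
     {h i * h j - h j * h i | i j. i \<in> I \<and> j \<in> I}
   \<union> {h i * e j - e j * h i - of_int (cartan n i j) * e j | i j. i \<in> I \<and> j \<in> I}
   \<union> {h i * f j - f j * h i + of_int (cartan n i j) * f j | i j. i \<in> I \<and> j \<in> I}
   \<union> {sbracket R (chdeg n i) (chdeg n j) (e i) (f j) - (if i = j then qbrk (h i) else 0)
        | i j. i \<in> I \<and> j \<in> I}
   \<union> (\<Union>x \<in> {e, f}.
        {sbracket R (chdeg n i) (chdeg n j) (x i) (x j)
          | i j. i \<in> I \<and> j \<in> I \<and> cartan n i j = 0}
      \<union> {qcomm 1 (x i) (qcomm (-1) (x i) (x j))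
          | i j. i \<in> I \<and> j \<in> I \<and> i \<noteq> n + 1 \<and> (j = i + 1 \<or> i = j + 1)}
      \<union> (if n \<ge> 1 \<and> m \<ge> 2
         then {sbracket R 1 1 (x (n+1)) (qcomm (-1) (qcomm 1 (x n) (x (n+1))) (x (n+2)))}
         else {})))"

abbreviation Uq :: "nat \<Rightarrow> nat \<Rightarrow> chevalley halg set ring" where
  "Uq n m \<equiv> halg (U_gens n m) (U_rels n m)"

text \<open>
  The Jacobson generators: \<open>H\<^sub>i\<close> is the diagonal element \<open>E\<^sub>0\<^sub>0 - (-1)\<^bsup>\<theta>\<^sub>i\<^esup> E\<^sub>i\<^sub>i\<close>, and \<open>a\<^sub>i\<^sup>-\<close>, \<open>a\<^sub>i\<^sup>+\<close>
  are the root vectors \<open>e\<^sub>0\<^sub>i\<close>, \<open>e\<^sub>i\<^sub>0\<close>, built up from the simple ones by \<open>q\<close>-commutators. The powers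
  of \<open>q\<close> in these are forced by \<open>[[a\<^sub>i\<^sup>-, a\<^sub>j\<^sup>+]] = - (-1)\<^bsup>\<theta>\<^sub>j\<^esup> e\<^sub>j\<^sub>i L\<^sub>j\<^sup>-\<^sup>1\<close> for \<open>j = i - 1\<close> and
  \<open>[[a\<^sub>i\<^sup>-, a\<^sub>j\<^sup>+]] = - (-1)\<^bsup>\<theta>\<^sub>i\<^esup> L\<^sub>i e\<^sub>j\<^sub>i\<close> for \<open>i = j - 1\<close>, where \<open>e\<^sub>j\<^sub>i\<close> is a Chevalley generator.
  Both recursions are meant for \<open>i \<ge> 1\<close> only.
\<close>
definition jacH :: "nat \<Rightarrow> nat \<Rightarrow> chevalley halg" where
  "jacH n i = (\<Sum>k\<in>{1..i}. (-1) ^ theta n (k - 1) * gen (ChH k))"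

fun jac_minus :: "nat \<Rightarrow> nat \<Rightarrow> chevalley halg" where
  "jac_minus n 0 = 0"
| "jac_minus n (Suc 0) = gen (ChE 1)"
| "jac_minus n (Suc (Suc i)) =
     qcomm (- ((-1) ^ theta n (Suc i))) (jac_minus n (Suc i)) (gen (ChE (Suc (Suc i))))"

fun jac_plus :: "nat \<Rightarrow> nat \<Rightarrow> chevalley halg" where
  "jac_plus n 0 = 0"
| "jac_plus n (Suc 0) = gen (ChF 1)"
| "jac_plus n (Suc (Suc i)) =
     qcomm ((-1) ^ theta n (Suc i)) (gen (ChF (Suc (Suc i)))) (jac_plus n (Suc i))"

abbreviation clU :: "nat \<Rightarrow> nat \<Rightarrow> chevalley halg \<Rightarrow> chevalley halg set" where
  "clU n m \<equiv> hclass (U_gens n m) (U_rels n m)"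

text \<open>\<open>e j i\<close> stands for the Cartan-Weyl element \<open>e\<^sub>j\<^sub>i\<close> with \<open>i \<noteq> j\<close> in \<open>[1; n+m]\<close>.\<close>
definition cartan_weyl :: "nat \<Rightarrow> nat \<Rightarrow> (nat \<Rightarrow> nat \<Rightarrow> chevalley halg set) \<Rightarrow> bool" where
  "cartan_weyl n m e \<longleftrightarrow>
     (\<forall>i\<in>{1..n+m}. \<forall>j\<in>{1..n+m}. i \<noteq> j \<longrightarrow>
        e j i \<in> carrier (Uq n m) \<and>
        sbracket (Uq n m) (theta n i) (theta n j) (clU n m (jac_minus n i)) (clU n m (jac_plus n j)) =
          (if i < j
           then [(- ((-1 :: int) ^ theta n i))] \<cdot>\<^bsub>Uq n m\<^esub>
                  (clU n m (qpow (jacH n i)) \<otimes>\<^bsub>Uq n m\<^esub> e j i)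
           else [(- ((-1 :: int) ^ theta n j))] \<cdot>\<^bsub>Uq n m\<^esub>
                  (e j i \<otimes>\<^bsub>Uq n m\<^esub> clU n m (qpow (- jacH n j)))))"


section \<open>The oscillator superalgebra \<open>W(n|m)\<close>\<close>

datatype oscillator = OMinus nat | OPlus nat

abbreviation cm :: "nat \<Rightarrow> oscillator halg" where "cm i \<equiv> gen (OMinus i)"
abbreviation cp :: "nat \<Rightarrow> oscillator halg" where "cp i \<equiv> gen (OPlus i)"

definition W_gens :: "nat \<Rightarrow> nat \<Rightarrow> oscillator set" where
  "W_gens n m = OMinus ` {1..n+m} \<union> OPlus ` {1..n+m}"

definition W_rels :: "nat \<Rightarrow> nat \<Rightarrow> oscillator halg set" where
  "W_rels n m = (let I = {1..n+m}; br = (\<lambda>i j. sbracket (hfree (W_gens n m)) (theta n i) (theta n j)) in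
     {br i j (cm i) (cp j) - (if i = j then 1 else 0) | i j. i \<in> I \<and> j \<in> I}
   \<union> {br i j (cp i) (cp j) | i j. i \<in> I \<and> j \<in> I}
   \<union> {br i j (cm i) (cm j) | i j. i \<in> I \<and> j \<in> I})"

abbreviation clW :: "nat \<Rightarrow> nat \<Rightarrow> oscillator halg \<Rightarrow> oscillator halg set" where
  "clW n m \<equiv> hclass (W_gens n m) (W_rels n m)"

definition Nop :: "nat \<Rightarrow> oscillator halg" where
  "Nop i = cp i * cm i"

definition Ntot :: "nat \<Rightarrow> nat \<Rightarrow> oscillator halg" where
  "Ntot n m = (\<Sum>j\<in>{1..n+m}. Nop j)"

text \<open>The Dyson realization with parameter \<open>p\<close>.\<close>
definition dyson :: "nat \<Rightarrow> nat \<Rightarrow> complex \<Rightarrow> (chevalley halg set \<Rightarrow> oscillator halg set) \<Rightarrow> bool" where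
  "dyson n m p \<rho> \<longleftrightarrow>
     \<rho> \<in> halg_hom (U_gens n m) (U_rels n m) (W_gens n m) (W_rels n m) \<and>
     (\<forall>i\<in>{1..n+m}.
        \<rho> (clU n m (jacH n i)) =
          clW n m (const p - (-1) ^ theta n i * Nop i - Ntot n m) \<and>
        \<rho> (clU n m (jac_minus n i)) =
          clW n m (qpow (\<Sum>k\<in>{1..<i}. Nop k) * qbrk_ratio (Nop i + 1)
                     * qbrk (const p - Ntot n m) * cm i) \<and>
        \<rho> (clU n m (jac_plus n i)) =
          clW n m (qpow (- (\<Sum>k\<in>{1..<i}. Nop k)) * cp i))"

end

(*
  Both sides of the defining relation of e_ji are computed modulo the closed ideal of relations of
  W(n|m). Every N_k x = x (N_k + const) for x = c_i^+, c_i^-, and such an intertwining relation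
  a x = x b passes to F(a) x = x F(b) for all power series F. Moving everything diagonal to the
  left, the superbracket collapses by [y] - q^-1 [y+1] = -q^(-y-1) for j < i and by
  q^-1 [y] - [y+1] = -q^y for i < j, where y = p - N; the factor L_i or L_j^-1 is invertible and
  what is left is a product of commuting powers of q. That rho (q^H) = q^(rho H) follows from
  C[[h]]-linearity, since the ideal of W(n|m) is h-adically closed.
*)
theory Submission
  imports Defs
begin

section \<open>Evaluation of power series in the free algebra\<close>

text \<open>Power series in the N_i are limits, and limits are available only in the free algebra:
  the quotient is a bare ring of cosets. The computation therefore runs on representatives, with a
  congruence in place of equality. The price is that the N_i commute only up to congruence, so no
  normalizer for commutative rings applies; reordering rests on membership in a bicommutant. The
  factor [N_i+1]/(N_i+1) commutes with c_j^+ for j \<noteq> i and is carried along unexpanded. The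
  signs match because theta is monotone: theta_i theta_j is the theta of the smaller index, the one
  in the defining relation of e_ji. In the exponent p and N cancel. For j < i there remain two
  copies of N_j - 1, one from the prefix N_1 + ... + N_(i-1) and one from H_j, with total weight 1 -
  (-1)^theta_j = 2 theta_j. The shift by 1 in the first copy is that of q^(-y-1); in the second it
  arises because L_j^-1 stands to the right of e_ji, so that H_j has to pass c_j^+ c_i^-. For i < j
  the factor L_i stands to the left and N_i stays unshifted.\<close>

lemma single_zero_central:
  fixes p :: "'g word \<Rightarrow>\<^sub>0 complex"
  shows "Poly_Mapping.single 0 c * p = p * Poly_Mapping.single 0 c"
proof (induction p rule: update_induct)
  case (update f k v)
  then have "Poly_Mapping.update k v f = Poly_Mapping.single k v + f"
    by (intro poly_mapping_eqI) (auto simp: lookup_update lookup_add lookup_single in_keys_iff)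
  with update.IH show ?case
    by (simp add: distrib_left distrib_right mult_single mult.commute)
qed simp

section \<open>Scalars and constants as central elements\<close>

lemma scal_nth: "fps_nth (scal s) k = Poly_Mapping.single 0 (fps_nth s k)"
  by (simp add: scal_def)

lemma single_sum:
  "Poly_Mapping.single k (\<Sum>i\<in>A. f i) = (\<Sum>i\<in>A. Poly_Mapping.single k (f i :: 'b::comm_monoid_add))"
  by (induction A rule: infinite_finite_induct) (auto simp: single_add)

lemma scal_0 [simp]: "scal 0 = 0"
  and scal_1 [simp]: "scal 1 = 1"
  and scal_add: "scal (s + t) = scal s + scal t"
  and scal_diff: "scal (s - t) = scal s - scal t"
  and scal_uminus: "scal (- s) = - scal s"
  and scal_X: "scal fps_X = fps_X"
  by (auto simp: fps_eq_iff scal_nth single_add single_diff single_uminus fps_one_nth fps_X_def)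

lemma scal_mult: "scal (s * t) = scal s * scal t"
  by (auto simp: fps_eq_iff scal_nth fps_mult_nth single_sum mult_single)

lemma scal_power: "scal (s ^ k) = scal s ^ k"
  by (induction k) (auto simp: scal_mult)

lemma scal_of_nat: "scal (of_nat k) = of_nat k"
  by (induction k) (auto simp: scal_add)

lemma scal_of_int: "scal (of_int k) = of_int k"
  by (cases k) (simp_all add: scal_of_nat scal_uminus scal_diff)

lemma scal_central: "scal s * a = a * scal s"
proof (rule fps_ext)
  fix k
  have "fps_nth (scal s * a) k = (\<Sum>i=0..k. fps_nth a (k - i) * fps_nth (scal s) i)"
    by (simp add: fps_mult_nth scal_nth single_zero_central)
  also have "\<dots> = fps_nth (a * scal s) k"
    unfolding fps_mult_nth
    by (rule sum.reindex_bij_witness[of _ "\<lambda>i. k - i" "\<lambda>i. k - i"]) auto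
  finally show "fps_nth (scal s * a) k = fps_nth (a * scal s) k" .
qed

lemma const_0 [simp]: "const 0 = 0"
  and const_1 [simp]: "const 1 = 1"
  and const_add: "const (c + d) = const c + const d"
  and const_uminus: "const (- c) = - const c"
  by (auto simp: const_def fps_const_add[symmetric] scal_add fps_const_neg[symmetric] scal_uminus
      simp del: fps_const_add fps_const_neg)

lemma const_mult: "const (c * d) = const c * const d"
  by (metis const_def fps_const_mult scal_mult)

lemma const_power: "const (c ^ k) = const c ^ k"
  by (induction k) (auto simp: const_mult)

lemma const_central: "const c * a = a * const c"
  by (simp add: const_def scal_central)

lemma const_left_commute: "a * (const c * b) = const c * (a * b)"
  by (metis const_central mult.assoc)

section \<open>Evaluation of polynomials at one element\<close>

lemma poly_at_degree_le:
  assumes "degree P \<le> d"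
  shows "poly_at P a = (\<Sum>i\<le>d. const (coeff P i) * a ^ i)"
  unfolding poly_at_def using assms
  by (intro sum.mono_neutral_left) (auto simp: coeff_eq_0)

lemma poly_at_0 [simp]: "poly_at 0 a = 0"
  by (simp add: poly_at_def)

lemma poly_at_pCons: "poly_at (pCons c P) a = const c + a * poly_at P a"
proof -
  have "poly_at (pCons c P) a = (\<Sum>i\<le>Suc (degree P). const (coeff (pCons c P) i) * a ^ i)"
    by (intro poly_at_degree_le degree_pCons_le)
  also have "\<dots> = const c + a * poly_at P a"
    by (subst sum.atMost_Suc_shift)
       (simp add: poly_at_def sum_distrib_left const_left_commute)
  finally show ?thesis .
qed

lemma poly_at_1 [simp]: "poly_at 1 a = 1"
  by (simp add: one_pCons poly_at_pCons)

lemma poly_at_add: "poly_at (P + Q) a = poly_at P a + poly_at Q a"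
proof -
  let ?d = "max (degree P) (degree Q)"
  have "degree (P + Q) \<le> ?d" by (simp add: degree_add_le_max)
  then show ?thesis
    by (simp add: poly_at_degree_le[of P ?d] poly_at_degree_le[of Q ?d] poly_at_degree_le[of _ ?d]
        const_add sum.distrib distrib_right)
qed

lemma poly_at_smult: "poly_at (smult c P) a = const c * poly_at P a"
  by (induction P) (auto simp: poly_at_pCons const_mult distrib_left const_left_commute)

lemma poly_at_uminus: "poly_at (- P) a = - poly_at P a"
  using poly_at_smult[of "-1" P a] by (simp add: const_uminus)

text \<open>Only central constants and powers of the single element \<open>a\<close> occur, so
  evaluation is multiplicative although the free algebra is not commutative.\<close>

lemma poly_at_mult: "poly_at (P * Q) a = poly_at P a * poly_at Q a"
  by (induction P) (auto simp: poly_at_pCons poly_at_add poly_at_smult distrib_right mult.assoc)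

lemma poly_at_power: "poly_at (P ^ k) a = poly_at P a ^ k"
  by (induction k) (auto simp: poly_at_mult)

lemma poly_at_sum: "poly_at (\<Sum>i\<in>A. f i) a = (\<Sum>i\<in>A. poly_at (f i) a)"
  by (induction A rule: infinite_finite_induct) (auto simp: poly_at_add)

lemma poly_at_pcompose: "poly_at (pcompose P Q) a = poly_at P (poly_at Q a)"
  by (induction P) (auto simp: pcompose_pCons poly_at_pCons poly_at_add poly_at_mult)

text \<open>\<open>hsum u\<close> is the \<open>h\<close>-adically convergent sum of the \<open>fps_X ^ i * u i\<close>.\<close>
definition hsum :: "(nat \<Rightarrow> 'a::ring_1 fps) \<Rightarrow> 'a fps" where
  "hsum u = Abs_fps (\<lambda>k. \<Sum>i\<le>k. fps_nth (u i) (k - i))"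

text \<open>Since \<open>fps_X\<close> lowers the coefficient index by one, peeling off one term
  turns identities between convergent sums into inductions on that index.\<close>

lemma hsum_rec: "hsum u = u 0 + fps_X * hsum (\<lambda>i. u (Suc i))"
proof (rule fps_ext)
  fix k
  show "fps_nth (hsum u) k = fps_nth (u 0 + fps_X * hsum (\<lambda>i. u (Suc i))) k"
    by (cases k) (auto simp: hsum_def sum.atMost_Suc_shift simp del: sum.atMost_Suc)
qed

text \<open>Finite part plus a multiple of h^k: the form in which sums are compared modulo a closed
  ideal.\<close>

lemma hsum_split: "hsum u = (\<Sum>i<k. fps_X ^ i * u i) + fps_X ^ k * hsum (\<lambda>i. u (i + k))"
proof (induction k)
  case (Suc k)
  have "hsum (\<lambda>i. u (i + k)) = u k + fps_X * hsum (\<lambda>i. u (i + Suc k))"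
    using hsum_rec[of "\<lambda>i. u (i + k)"] by simp
  with Suc show ?case
    by (simp add: distrib_left power_Suc2 mult.assoc add.assoc del: power_Suc)
qed simp

lemma hsum_add: "hsum u + hsum v = hsum (\<lambda>i. u i + v i)"
  by (auto simp: fps_eq_iff hsum_def sum.distrib)

lemma hsum_uminus: "- hsum u = hsum (\<lambda>i. - u i)"
  by (auto simp: fps_eq_iff hsum_def sum_negf)

lemma hsum_diff: "hsum u - hsum v = hsum (\<lambda>i. u i - v i)"
  by (auto simp: fps_eq_iff hsum_def sum_subtractf)

lemma hsum_mult_left: "a * hsum u = hsum (\<lambda>i. a * u i)"
proof (rule fps_ext)
  fix k
  \<comment> \<open>Each peeled term replaces \<open>u\<close> by its shift, hence the induction is
    for all \<open>u\<close>.\<close>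
  have *: "fps_nth (a * hsum u) k = fps_nth (hsum (\<lambda>i. a * u i)) k" for u
  proof (induction k arbitrary: u rule: less_induct)
    case (less k)
    have "a * hsum u = a * u 0 + fps_X * (a * hsum (\<lambda>i. u (Suc i)))"
      by (subst hsum_rec) (metis distrib_left fps_mult_fps_X_commute mult.assoc)
    moreover have "hsum (\<lambda>i. a * u i) = a * u 0 + fps_X * hsum (\<lambda>i. a * u (Suc i))"
      by (subst hsum_rec) simp
    ultimately show ?case using less[of "k - 1"] by (cases k) auto
  qed
  show "fps_nth (a * hsum u) k = fps_nth (hsum (\<lambda>i. a * u i)) k" by (rule *)
qed

lemma hsum_mult_right: "hsum u * a = hsum (\<lambda>i. u i * a)"
proof (rule fps_ext)
  fix k
  show "fps_nth (hsum u * a) k = fps_nth (hsum (\<lambda>i. u i * a)) k"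
  proof (induction k arbitrary: u rule: less_induct)
    case (less k)
    have "hsum u * a = u 0 * a + fps_X * (hsum (\<lambda>i. u (Suc i)) * a)"
      by (subst hsum_rec) (simp only: distrib_right mult.assoc)
    moreover have "hsum (\<lambda>i. u i * a) = u 0 * a + fps_X * hsum (\<lambda>i. u (Suc i) * a)"
      by (subst hsum_rec) simp
    ultimately show ?case using less[of "k - 1"] by (cases k) auto
  qed
qed

text \<open>The Cauchy product for terms that are themselves series in h and need not commute; the
  order of the factors is kept.\<close>

lemma hsum_mult: "hsum u * hsum v = hsum (\<lambda>l. \<Sum>i\<le>l. u i * v (l - i))"
proof (rule fps_ext)
  fix k
  show "fps_nth (hsum u * hsum v) k = fps_nth (hsum (\<lambda>l. \<Sum>i\<le>l. u i * v (l - i))) k"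
  proof (induction k arbitrary: u rule: less_induct)
    case (less k)
    have "hsum u * hsum v = hsum (\<lambda>i. u 0 * v i) + fps_X * (hsum (\<lambda>i. u (Suc i)) * hsum v)"
      by (subst hsum_rec[of u]) (simp only: distrib_right hsum_mult_left[of "u 0"] mult.assoc)
    moreover have "hsum (\<lambda>l. \<Sum>i\<le>l. u i * v (l - i)) = hsum (\<lambda>i. u 0 * v i)
        + fps_X * hsum (\<lambda>l. \<Sum>i\<le>l. u (Suc i) * v (l - i))"
    proof -
      \<comment> \<open>The row \<open>i = 0\<close> of the convolution is split off; the other rows
        are empty at \<open>l = 0\<close>, which makes them a multiple of
        \<open>fps_X\<close>.\<close>
      have "hsum (\<lambda>l. \<Sum>i\<le>l. u i * v (l - i)) = hsum (\<lambda>l. u 0 * v l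
          + (case l of 0 \<Rightarrow> 0 | Suc l' \<Rightarrow> \<Sum>i\<le>l'. u (Suc i) * v (l' - i)))"
        by (rule arg_cong[of _ _ hsum])
           (auto simp: fun_eq_iff sum.atMost_Suc_shift simp del: sum.atMost_Suc split: nat.split)
      also have "\<dots> = hsum (\<lambda>i. u 0 * v i)
          + hsum (\<lambda>l. case l of 0 \<Rightarrow> 0 | Suc l' \<Rightarrow> \<Sum>i\<le>l'. u (Suc i) * v (l' - i))"
        by (rule hsum_add[symmetric])
      also have "hsum (\<lambda>l. case l of 0 \<Rightarrow> 0 | Suc l' \<Rightarrow> \<Sum>i\<le>l'. u (Suc i) * v (l' - i))
          = fps_X * hsum (\<lambda>l. \<Sum>i\<le>l. u (Suc i) * v (l - i))"
        by (subst hsum_rec) simp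
      finally show ?thesis .
    qed
    ultimately show ?case using less[of "k - 1"] by (cases k) auto
  qed
qed

section \<open>Evaluation of power series and the exponential\<close>

lemma series_at_hsum: "series_at F a = hsum (\<lambda>k. poly_at (fps_nth F k) a)"
  by (simp add: fps_eq_iff series_at_nth hsum_def)

lemma series_at_add: "series_at (F + G) a = series_at F a + series_at G a"
  by (simp add: series_at_hsum hsum_add poly_at_add)

lemma series_at_uminus: "series_at (- F) a = - series_at F a"
  by (simp add: series_at_hsum hsum_uminus poly_at_uminus)

lemma series_at_diff: "series_at (F - G) a = series_at F a - series_at G a"
  using series_at_add[of F "- G" a] by (simp add: series_at_uminus)

lemma series_at_mult: "series_at (F * G) a = series_at F a * series_at G a"
  by (simp add: series_at_hsum hsum_mult fps_mult_nth poly_at_sum poly_at_mult atLeast0AtMost)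

lemma poly_at_X [simp]: "poly_at [:0, 1:] a = a"
  by (simp add: poly_at_pCons)

text \<open>Any power of q with exponent polynomial in \<open>a\<close> becomes a series at
  \<open>a\<close> itself, so identities can be checked once with the commuting variable x.\<close>

lemma qpow_poly_at: "qpow (poly_at P a) = series_at (pexp P) a"
  by (simp add: series_at_hsum pexp_def poly_at_smult poly_at_power)

lemma qpow_0: "qpow 0 = 1"
proof -
  have "pexp 0 = 1"
    by (auto simp: pexp_def fps_eq_iff fps_one_nth power_0_left)
  moreover have "series_at 1 a = 1" for a :: "'g halg"
  proof -
    have "series_at 1 a = hsum (\<lambda>i. if i = 0 then 1 else 0)"
      by (auto simp: series_at_hsum fps_one_nth intro!: arg_cong[of _ _ hsum])
    also have "\<dots> = 1"
      by (subst hsum_rec) (auto simp: fps_eq_iff hsum_def)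
    finally show ?thesis .
  qed
  ultimately show ?thesis using qpow_poly_at[of 0 "0"] by (metis poly_at_0)
qed

lemma smult_sum_right: "smult c (\<Sum>i\<in>A. f i) = (\<Sum>i\<in>A. smult c (f i))"
  by (induction A rule: infinite_finite_induct) (auto simp: smult_add_right)

lemma pexp_add: "pexp (a + b) = pexp a * pexp b"
proof (rule fps_ext)
  fix k
  have "smult (1 / fact k) ((a + b) ^ k)
      = (\<Sum>i\<le>k. smult (1 / fact k) (of_nat (k choose i) * a ^ i * b ^ (k - i)))"
    by (simp add: binomial_ring smult_sum_right)
  also have "\<dots> = (\<Sum>i\<le>k. smult (1 / fact i) (a ^ i) * smult (1 / fact (k - i)) (b ^ (k - i)))"
    by (intro sum.cong) (auto simp: of_nat_poly binomial_fact mult.commute)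
  finally show "fps_nth (pexp (a + b)) k = fps_nth (pexp a * pexp b) k"
    by (simp add: pexp_def fps_mult_nth atLeast0AtMost)
qed

section \<open>The two q-number identities\<close>

definition shift :: "complex poly fps \<Rightarrow> complex poly fps" where
  "shift F = Abs_fps (\<lambda>k. pcompose (fps_nth F k) [:1, 1:])"

lemma shift_mult: "shift (F * G) = shift F * shift G"
  by (simp add: fps_eq_iff shift_def fps_mult_nth pcompose_sum pcompose_mult)

lemma shift_diff: "shift (F - G) = shift F - shift G"
  by (simp add: fps_eq_iff shift_def pcompose_diff)

lemma shift_pexp: "shift (pexp P) = pexp (pcompose P [:1, 1:])"
proof -
  have "pcompose (P ^ k) [:1, 1:] = pcompose P [:1, 1:] ^ k" for k
    by (induction k) (auto simp: pcompose_mult pcompose_1)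
  then show ?thesis by (simp add: shift_def pexp_def pcompose_smult fps_eq_iff)
qed

text \<open>Through this, [y+1] is a series at y, and relations between [y] and [y+1] become
  identities in \<complex>[x][[h]].\<close>

lemma series_at_shift: "series_at (shift F) a = series_at F (a + 1)"
  by (simp add: series_at_hsum shift_def poly_at_pcompose poly_at_pCons add.commute)

text \<open>At h = 0 the denominator q - q^-1 vanishes, so it is not invertible; q-number identities
  are multiplied by it and then cancelled in an integral domain.\<close>

lemma pexp_diff_neq_0: "pexp 1 - pexp (-1) \<noteq> 0"
proof
  assume "pexp 1 - pexp (-1) = 0"
  then have "fps_nth (pexp 1 - pexp (-1)) 1 = 0" by simp
  then show False by (simp add: pexp_def one_pCons)
qed

text \<open>The denominator does not involve x, so the substitution acts on the numerator
  alone.\<close>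

lemma shift_qint: "shift qint * (pexp 1 - pexp (-1)) = pexp [:1, 1:] - pexp (- [:1, 1:])"
proof -
  have "shift (qint * (pexp 1 - pexp (-1))) = pexp [:1, 1:] - pexp (- [:1, 1:])"
    by (simp only: qint shift_diff shift_pexp)
       (simp add: pcompose_pCons)
  moreover have "shift (pexp 1 - pexp (-1)) = pexp 1 - pexp (-1)"
    by (simp add: shift_diff shift_pexp pcompose_uminus pcompose_1)
  ultimately show ?thesis by (metis shift_mult)
qed

text \<open>In the numerator the two q^x cancel, and q^(-x-2) - q^(-x) is -q^(-x-1) (q -
  q^-1).\<close>

lemma qint_minus_shift: "qint - pexp (-1) * shift qint = - pexp [:-1, -1:]"
proof -
  have "(qint - pexp (-1) * shift qint) * (pexp 1 - pexp (-1))
     = pexp [:0, 1:] - pexp (- [:0, 1:]) - pexp (-1) * (pexp [:1, 1:] - pexp (- [:1, 1:]))"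
    by (simp only: left_diff_distrib mult.assoc qint shift_qint)
  also have "\<dots> = - pexp [:-1, -1:] * (pexp 1 - pexp (-1))"
    by (simp add: right_diff_distrib pexp_add[symmetric] one_pCons)
  finally show ?thesis using pexp_diff_neq_0 mult_right_cancel by blast
qed

text \<open>Here the two q^(-x-1) cancel, and q^(x-1) - q^(x+1) is -q^x (q - q^-1).\<close>

lemma shift_minus_qint: "pexp (-1) * qint - shift qint = - pexp [:0, 1:]"
proof -
  have "(pexp (-1) * qint - shift qint) * (pexp 1 - pexp (-1))
     = pexp (-1) * (pexp [:0, 1:] - pexp (- [:0, 1:])) - (pexp [:1, 1:] - pexp (- [:1, 1:]))"
    by (simp only: left_diff_distrib mult.assoc qint shift_qint)
  also have "\<dots> = - pexp [:0, 1:] * (pexp 1 - pexp (-1))"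
    by (simp add: right_diff_distrib pexp_add[symmetric] one_pCons)
  finally show ?thesis using pexp_diff_neq_0 mult_right_cancel by blast
qed

lemma series_at_pexp_minus_1: "series_at (pexp (-1)) a = qpow (-1)"
  using qpow_poly_at[of "-1" a] by (simp add: poly_at_uminus)

lemma qbrk_minus_shift: "qbrk a - qpow (-1) * qbrk (a + 1) = - qpow (- a - 1)"
proof -
  have "qbrk a - qpow (-1) * qbrk (a + 1) = series_at (qint - pexp (-1) * shift qint) a"
    by (simp add: series_at_diff series_at_mult series_at_shift series_at_pexp_minus_1)
  also have "\<dots> = - qpow (- a - 1)"
    using qpow_poly_at[of "[:-1, -1:]" a]
    by (simp add: qint_minus_shift series_at_uminus poly_at_pCons const_uminus minus_diff_commute)
  finally show ?thesis .
qed

lemma shift_minus_qbrk: "qpow (-1) * qbrk a - qbrk (a + 1) = - qpow a"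
proof -
  have "qpow (-1) * qbrk a - qbrk (a + 1) = series_at (pexp (-1) * qint - shift qint) a"
    by (simp add: series_at_diff series_at_mult series_at_shift series_at_pexp_minus_1)
  then show ?thesis by (simp add: shift_minus_qint series_at_uminus)
qed

section \<open>Congruence modulo a closed ideal\<close>

lemma hfree_simps [simp]:
  "x \<otimes>\<^bsub>hfree X\<^esub> y = x * y" "x \<oplus>\<^bsub>hfree X\<^esub> y = x + y"
  "\<one>\<^bsub>hfree X\<^esub> = 1" "\<zero>\<^bsub>hfree X\<^esub> = 0"
  by (simp_all add: hfree_def)

lemma hfree_zero: "0 \<in> carrier (hfree X)"
  and hfree_one: "1 \<in> carrier (hfree X)"
  and hfree_add: "a \<in> carrier (hfree X) \<Longrightarrow> b \<in> carrier (hfree X) \<Longrightarrow> a + b \<in> carrier (hfree X)"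
  and hfree_mult: "a \<in> carrier (hfree X) \<Longrightarrow> b \<in> carrier (hfree X) \<Longrightarrow> a * b \<in> carrier (hfree X)"
proof -
  interpret R: ring "hfree X" by (rule ring_hfree)
  show "0 \<in> carrier (hfree X)" "1 \<in> carrier (hfree X)"
    "a \<in> carrier (hfree X) \<Longrightarrow> b \<in> carrier (hfree X) \<Longrightarrow> a + b \<in> carrier (hfree X)"
    "a \<in> carrier (hfree X) \<Longrightarrow> b \<in> carrier (hfree X) \<Longrightarrow> a * b \<in> carrier (hfree X)"
    using R.zero_closed R.one_closed R.add.m_closed R.m_closed by simp_all
qed

lemma hfree_uminus: "a \<in> carrier (hfree X) \<Longrightarrow> - a \<in> carrier (hfree X)"
  by (simp add: hfree_def keys_minus)

lemma hfree_diff: "a \<in> carrier (hfree X) \<Longrightarrow> b \<in> carrier (hfree X) \<Longrightarrow> a - b \<in> carrier (hfree X)"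
  by (metis diff_conv_add_uminus hfree_add hfree_uminus)

lemma hfree_power: "a \<in> carrier (hfree X) \<Longrightarrow> a ^ k \<in> carrier (hfree X)"
  by (induction k) (auto intro: hfree_one hfree_mult)

lemma hfree_sum: "(\<And>i. i \<in> A \<Longrightarrow> f i \<in> carrier (hfree X)) \<Longrightarrow> (\<Sum>i\<in>A. f i) \<in> carrier (hfree X)"
  by (induction A rule: infinite_finite_induct) (auto intro: hfree_zero hfree_add)

lemma hfree_scal: "scal s \<in> carrier (hfree X)"
  by (auto simp: hfree_def scal_nth zero_word_def split: if_splits)

lemma hfree_const: "const c \<in> carrier (hfree X)"
  by (simp add: const_def hfree_scal)

lemma hfree_of_int: "of_int k \<in> carrier (hfree X)"
  by (metis hfree_scal scal_of_int)

lemma hfree_X: "fps_X \<in> carrier (hfree X)"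
  by (metis hfree_scal scal_X)

lemma hfree_gen: "g \<in> X \<Longrightarrow> gen g \<in> carrier (hfree X)"
  by (auto simp: hfree_def gen_def fps_const_def)

lemma hfree_hsum: "(\<And>i. u i \<in> carrier (hfree X)) \<Longrightarrow> hsum u \<in> carrier (hfree X)"
  unfolding hfree_def hsum_def
  using keys_sum by fastforce

lemma hfree_poly_at: "a \<in> carrier (hfree X) \<Longrightarrow> poly_at P a \<in> carrier (hfree X)"
  unfolding poly_at_def by (intro hfree_sum hfree_mult hfree_const hfree_power)

lemma hfree_series_at: "a \<in> carrier (hfree X) \<Longrightarrow> series_at F a \<in> carrier (hfree X)"
  unfolding series_at_hsum by (intro hfree_hsum hfree_poly_at)

lemmas hfree_closed = hfree_zero hfree_one hfree_add hfree_mult hfree_uminus hfree_diff hfree_power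
  hfree_sum hfree_scal hfree_const hfree_of_int hfree_X hfree_gen hfree_series_at

section \<open>Signs and superbrackets in abstract rings and in the free algebra\<close>

lemma a_inv_hfree: "a \<in> carrier (hfree X) \<Longrightarrow> \<ominus>\<^bsub>hfree X\<^esub> a = - a"
  by (rule abelian_group.minus_equality[OF ring.is_abelian_group[OF ring_hfree]])
     (simp_all add: hfree_uminus)

lemma a_minus_hfree:
  "a \<in> carrier (hfree X) \<Longrightarrow> b \<in> carrier (hfree X) \<Longrightarrow> a \<ominus>\<^bsub>hfree X\<^esub> b = a - b"
  by (simp add: a_minus_def a_inv_hfree)

lemma add_pow_int_1: "ring R \<Longrightarrow> x \<in> carrier R \<Longrightarrow> [(1::int)] \<cdot>\<^bsub>R\<^esub> x = x"
  using group.int_pow_1[OF abelian_group.a_group[OF ring.is_abelian_group], of R x]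
  by (simp add: add_pow_def)

lemma add_pow_int_minus_1: "ring R \<Longrightarrow> x \<in> carrier R \<Longrightarrow> [(-1::int)] \<cdot>\<^bsub>R\<^esub> x = \<ominus>\<^bsub>R\<^esub> x"
  using group.int_pow_neg[OF abelian_group.a_group[OF ring.is_abelian_group], of R x 1]
    group.int_pow_1[OF abelian_group.a_group[OF ring.is_abelian_group], of R x]
  by (simp add: add_pow_def a_inv_def)

text \<open>All integer multiples in superbrackets and Cartan-Weyl relations are signs, so a parity
  split replaces a general theory of multiples.\<close>

lemma add_pow_sign_hom:
  assumes "ring R" "ring S" "f \<in> ring_hom R S" "x \<in> carrier R"
  shows "f ([((-1::int) ^ k)] \<cdot>\<^bsub>R\<^esub> x) = [((-1::int) ^ k)] \<cdot>\<^bsub>S\<^esub> f x"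
proof -
  interpret ring_hom_ring R S f using assms by (intro ring_hom_ringI2)
  show ?thesis
    using assms by (cases "even k") (auto simp: add_pow_int_1 add_pow_int_minus_1)
qed

lemma add_pow_sign_hfree:
  "a \<in> carrier (hfree X) \<Longrightarrow> [((-1::int) ^ k)] \<cdot>\<^bsub>hfree X\<^esub> a = (-1) ^ k * a"
  by (cases "even k") (auto simp: add_pow_int_1 add_pow_int_minus_1 ring_hfree a_inv_hfree)

lemma sbracket_hom:
  assumes "ring R" "ring S" "f \<in> ring_hom R S" "x \<in> carrier R" "y \<in> carrier R"
  shows "f (sbracket R d d' x y) = sbracket S d d' (f x) (f y)"
proof -
  interpret ring_hom_ring R S f using assms by (intro ring_hom_ringI2)
  have "[((-1::int) ^ (d * d'))] \<cdot>\<^bsub>R\<^esub> (y \<otimes>\<^bsub>R\<^esub> x) \<in> carrier R"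
    using assms by (cases "even (d * d')") (auto simp: add_pow_int_1 add_pow_int_minus_1)
  then show ?thesis
    using assms by (simp add: sbracket_def a_minus_def add_pow_sign_hom)
qed

lemma sbracket_hfree:
  assumes "a \<in> carrier (hfree X)" "b \<in> carrier (hfree X)"
  shows "sbracket (hfree X) d d' a b = a * b - (-1) ^ (d * d') * b * a"
proof -
  have "(-1) ^ (d * d') * (b * a) \<in> carrier (hfree X)"
    using assms by (intro hfree_closed)
  then show ?thesis
    using assms by (simp add: sbracket_def add_pow_sign_hfree a_minus_hfree hfree_mult mult.assoc)
qed

section \<open>Calculus of congruences\<close>

locale closed_ideal =
  fixes X :: "'g set" and I :: "'g halg set"
  assumes ideal: "ideal I (hfree X)" and closed: "closed I"
begin

interpretation I: ideal I "hfree X" by (rule ideal)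

text \<open>Membership of both sides in the carrier is built in, so a chain of congruences also
  delivers what is needed to return to cosets.\<close>

definition eqv (infix "\<doteq>" 50) where
  "a \<doteq> b \<longleftrightarrow> a \<in> carrier (hfree X) \<and> b \<in> carrier (hfree X) \<and> a - b \<in> I"

lemma I_zero: "0 \<in> I"
  using additive_subgroup.zero_closed[OF I.is_additive_subgroup] by simp

lemma I_add: "a \<in> I \<Longrightarrow> b \<in> I \<Longrightarrow> a + b \<in> I"
  using additive_subgroup.a_closed[OF I.is_additive_subgroup] by simp

lemma I_mult_left: "a \<in> I \<Longrightarrow> b \<in> carrier (hfree X) \<Longrightarrow> b * a \<in> I"
  using I.I_l_closed by simp

lemma I_mult_right: "a \<in> I \<Longrightarrow> b \<in> carrier (hfree X) \<Longrightarrow> a * b \<in> I"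
  using I.I_r_closed by simp

lemma I_uminus: "a \<in> I \<Longrightarrow> - a \<in> I"
  by (metis I_mult_left hfree_one hfree_uminus mult_minus1)

lemma I_sum: "(\<And>i. i \<in> A \<Longrightarrow> f i \<in> I) \<Longrightarrow> (\<Sum>i\<in>A. f i) \<in> I"
  by (induction A rule: infinite_finite_induct) (auto intro: I_zero I_add)

lemma eqv_refl: "a \<in> carrier (hfree X) \<Longrightarrow> a \<doteq> a"
  by (simp add: eqv_def I_zero)

lemma eqv_sym: "a \<doteq> b \<Longrightarrow> b \<doteq> a"
  using I_uminus[of "a - b"] by (simp add: eqv_def)

lemma eqv_trans [trans]: "a \<doteq> b \<Longrightarrow> b \<doteq> c \<Longrightarrow> a \<doteq> c"
  using I_add[of "a - b" "b - c"] by (simp add: eqv_def)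

lemma eqv_add: "a \<doteq> b \<Longrightarrow> c \<doteq> d \<Longrightarrow> a + c \<doteq> b + d"
  using I_add[of "a - b" "c - d"] by (simp add: eqv_def hfree_add algebra_simps)

lemma eqv_uminus: "a \<doteq> b \<Longrightarrow> - a \<doteq> - b"
  using I_uminus[of "a - b"] by (simp add: eqv_def hfree_uminus)

lemma eqv_diff: "a \<doteq> b \<Longrightarrow> c \<doteq> d \<Longrightarrow> a - c \<doteq> b - d"
  using eqv_add[of a b "- c" "- d"] eqv_uminus by simp

lemma eqv_mult: "a \<doteq> b \<Longrightarrow> c \<doteq> d \<Longrightarrow> a * c \<doteq> b * d"
proof -
  assume *: "a \<doteq> b" "c \<doteq> d"
  then have "(a - b) * c + b * (c - d) \<in> I"
    by (intro I_add I_mult_left I_mult_right) (auto simp: eqv_def)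
  with * show ?thesis by (simp add: eqv_def hfree_mult algebra_simps)
qed

lemma eqv_carrier: "a \<doteq> b \<Longrightarrow> a \<in> carrier (hfree X)" "a \<doteq> b \<Longrightarrow> b \<in> carrier (hfree X)"
  by (simp_all add: eqv_def)

lemma eqv_mult_left: "a \<in> carrier (hfree X) \<Longrightarrow> b \<doteq> c \<Longrightarrow> a * b \<doteq> a * c"
  by (intro eqv_mult eqv_refl)

lemma eqv_mult_right: "a \<in> carrier (hfree X) \<Longrightarrow> b \<doteq> c \<Longrightarrow> b * a \<doteq> c * a"
  by (intro eqv_mult eqv_refl)

lemma eqv_sum: "(\<And>i. i \<in> A \<Longrightarrow> f i \<doteq> g i) \<Longrightarrow> (\<Sum>i\<in>A. f i) \<doteq> (\<Sum>i\<in>A. g i)"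
  by (induction A rule: infinite_finite_induct) (auto intro: eqv_add eqv_refl hfree_zero)

text \<open>Here closedness enters: the elements a - h^k w_k of \<open>I\<close> converge h-adically
  to \<open>a\<close>.\<close>

lemma in_I_limit:
  assumes "\<And>k. \<exists>w\<in>carrier (hfree X). a - fps_X ^ k * w \<in> I"
  shows "a \<in> I"
proof -
  from assms obtain w where w: "\<And>k. a - fps_X ^ k * w k \<in> I" by metis
  have "(\<lambda>k. a - fps_X ^ k * w k) \<longlonglongrightarrow> a"
    unfolding tendsto_fps_iff eventually_sequentially
  proof
    fix l
    show "\<exists>N. \<forall>k\<ge>N. fps_nth (a - fps_X ^ k * w k) l = fps_nth a l"
      by (rule exI[of _ "Suc l"]) (auto simp: fps_X_power_mult_nth)
  qed
  from closed_sequentially[OF closed w this] show ?thesis .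
qed

text \<open>After k terms the difference of the sums is an element of \<open>I\<close> plus h^k
  times an element of the carrier, for every k.\<close>

lemma eqv_hsum:
  assumes "\<And>i. u i \<doteq> v i"
  shows "hsum u \<doteq> hsum v"
proof -
  have C: "u i \<in> carrier (hfree X)" "v i \<in> carrier (hfree X)" for i
    using assms eqv_carrier by blast+
  have "hsum u - hsum v \<in> I"
  proof (rule in_I_limit)
    fix k
    let ?w = "hsum (\<lambda>i. u (i + k) - v (i + k))"
    have "(\<Sum>i<k. fps_X ^ i * (u i - v i)) \<in> I"
      using assms by (intro I_sum I_mult_left hfree_closed) (auto simp: eqv_def)
    moreover have "hsum u - hsum v - fps_X ^ k * ?w = (\<Sum>i<k. fps_X ^ i * (u i - v i))"
      by (simp add: hsum_diff) (subst hsum_split[of _ k], simp)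
    moreover have "?w \<in> carrier (hfree X)"
      by (intro hfree_hsum hfree_diff C)
    ultimately show "\<exists>w\<in>carrier (hfree X). hsum u - hsum v - fps_X ^ k * w \<in> I"
      by (intro bexI[of _ ?w]) (simp_all only:)
  qed
  with C show ?thesis by (simp add: eqv_def hfree_hsum)
qed

section \<open>Moving power series past an element\<close>

lemma poly_at_intertwine:
  assumes "a * x \<doteq> x * b" "a \<in> carrier (hfree X)" "b \<in> carrier (hfree X)" "x \<in> carrier (hfree X)"
  shows "poly_at P a * x \<doteq> x * poly_at P b"
proof (induction P)
  case 0
  then show ?case by (simp add: eqv_refl hfree_zero)
next
  case (pCons c P)
  have "a * poly_at P a * x \<doteq> x * (b * poly_at P b)"
  proof -
    have "a * (poly_at P a * x) \<doteq> a * (x * poly_at P b)"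
      using assms pCons by (intro eqv_mult_left)
    also have "a * (x * poly_at P b) = a * x * poly_at P b" by (simp add: mult.assoc)
    also have "\<dots> \<doteq> x * b * poly_at P b"
      using assms by (intro eqv_mult_right hfree_poly_at)
    finally show ?thesis by (simp add: mult.assoc)
  qed
  moreover have "const c * x \<doteq> x * const c"
    using assms by (simp add: const_central eqv_refl hfree_closed)
  ultimately show ?case
    using eqv_add by (fastforce simp: poly_at_pCons distrib_left distrib_right)
qed

text \<open>Allowing \<open>b\<close> to differ from \<open>a\<close> covers commutation and the
  shift of N_k past an oscillator by one statement.\<close>

lemma series_at_intertwine:
  assumes "a * x \<doteq> x * b" "a \<in> carrier (hfree X)" "b \<in> carrier (hfree X)" "x \<in> carrier (hfree X)"
  shows "series_at F a * x \<doteq> x * series_at F b"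
  unfolding series_at_hsum hsum_mult_left hsum_mult_right
  using assms by (intro eqv_hsum poly_at_intertwine)

lemma qpow_hsum: "qpow a = hsum (\<lambda>k. const (1 / fact k) * a ^ k)" for a :: "'g halg"
  by (simp add: series_at_hsum pexp_def poly_at_smult poly_at_power)

text \<open>As \<open>a\<close> and \<open>b\<close> commute only modulo the ideal, the binomial
  theorem is out of reach. The induction instead uses the recursion (l+1) T_(l+1)(c) = c T_l(c) of
  the exponential series, for c = a, b and a + b.\<close>

lemma exp_term_add:
  assumes "a * b \<doteq> b * a" "a \<in> carrier (hfree X)" "b \<in> carrier (hfree X)"
  defines "T \<equiv> \<lambda>a k. const (1 / fact k) * a ^ k"
  shows "T (a + b) l \<doteq> (\<Sum>i\<le>l. T a i * T b (l - i))"
proof (induction l)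
  case 0
  then show ?case by (simp add: T_def eqv_refl hfree_one)
next
  case (Suc l)
  have TC: "T c i \<in> carrier (hfree X)" if "c \<in> carrier (hfree X)" for c i
    unfolding T_def using that by (intro hfree_closed)
  have step: "c * T c i = const (of_nat (Suc i)) * T c (Suc i)" for c i
  proof -
    have "const (of_nat (Suc i)) * T c (Suc i) = const (of_nat (Suc i) * (1 / fact (Suc i))) * (c * c ^ i)"
      unfolding T_def by (simp only: const_mult mult.assoc power_Suc)
    also have "of_nat (Suc i) * (1 / fact (Suc i)) = (1 / fact i :: complex)"
      by (simp del: of_nat_Suc)
    also have "const (1 / fact i) * (c * c ^ i) = c * T c i"
      unfolding T_def by (rule const_left_commute[symmetric])
    finally show ?thesis ..
  qed
  \<comment> \<open>\<open>T a i\<close> is a polynomial in \<open>a\<close>, so commutation with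
    \<open>b\<close> passes to it.\<close>
  have bT: "b * T a i \<doteq> T a i * b" for i
  proof -
    have "poly_at (smult (1 / fact i) ([:0, 1:] ^ i)) a * b
        \<doteq> b * poly_at (smult (1 / fact i) ([:0, 1:] ^ i)) a"
      using assms by (intro poly_at_intertwine)
    then show ?thesis by (simp add: T_def poly_at_smult poly_at_power eqv_sym)
  qed
  have "(a + b) * T (a + b) l \<doteq> (a + b) * (\<Sum>i\<le>l. T a i * T b (l - i))"
    using assms Suc by (intro eqv_mult_left hfree_closed)
  also have "\<dots> = (\<Sum>i\<le>l. a * T a i * T b (l - i) + b * T a i * T b (l - i))"
    by (simp add: sum_distrib_left distrib_right mult.assoc)
  also have "\<dots> \<doteq> (\<Sum>i\<le>l. a * T a i * T b (l - i) + T a i * b * T b (l - i))"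
    using assms(2,3) by (intro eqv_sum eqv_add eqv_refl eqv_mult_right bT TC hfree_closed)
  also have "\<dots> = (\<Sum>i\<le>l. const (of_nat (Suc i)) * T a (Suc i) * T b (l - i))
      + (\<Sum>i\<le>l. T a i * (const (of_nat (Suc (l - i))) * T b (Suc (l - i))))"
    by (simp only: sum.distrib step mult.assoc)
  \<comment> \<open>Both sums are extended to i \<le> l + 1. The added terms, i = 0 here and i = l +
    1 in the next step, have weight 0, and the weights i and l + 1 - i then add up to l + 1.\<close>
  also have "(\<Sum>i\<le>l. const (of_nat (Suc i)) * T a (Suc i) * T b (l - i))
      = (\<Sum>i\<le>Suc l. const (of_nat i) * T a i * T b (Suc l - i))"
    by (subst sum.atMost_Suc_shift) simp
  also have "(\<Sum>i\<le>l. T a i * (const (of_nat (Suc (l - i))) * T b (Suc (l - i))))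
      = (\<Sum>i\<le>Suc l. const (of_nat (Suc l - i)) * T a i * T b (Suc l - i))"
    by (simp add: Suc_diff_le const_left_commute mult.assoc add_diff_eq)
  also have "(\<Sum>i\<le>Suc l. const (of_nat i) * T a i * T b (Suc l - i))
      + (\<Sum>i\<le>Suc l. const (of_nat (Suc l - i)) * T a i * T b (Suc l - i))
      = const (of_nat (Suc l)) * (\<Sum>i\<le>Suc l. T a i * T b (Suc l - i))"
    unfolding sum_distrib_left sum.distrib[symmetric]
  proof (intro sum.cong refl)
    fix i assume "i \<in> {..Suc l}"
    then have "complex_of_nat (Suc l) = of_nat i + of_nat (Suc l - i)"
      by (metis atMost_iff le_add_diff_inverse of_nat_add)
    then show "const (of_nat i) * T a i * T b (Suc l - i) + const (of_nat (Suc l - i)) * T a i * T b (Suc l - i)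
        = const (of_nat (Suc l)) * (T a i * T b (Suc l - i))"
      by (simp only: const_add distrib_right mult.assoc)
  qed
  finally have "const (of_nat (Suc l)) * T (a + b) (Suc l)
      \<doteq> const (of_nat (Suc l)) * (\<Sum>i\<le>Suc l. T a i * T b (Suc l - i))"
    by (simp only: step)
  then have "const (1 / of_nat (Suc l)) * (const (of_nat (Suc l)) * T (a + b) (Suc l))
      \<doteq> const (1 / of_nat (Suc l)) * (const (of_nat (Suc l)) * (\<Sum>i\<le>Suc l. T a i * T b (Suc l - i)))"
    by (rule eqv_mult_left[OF hfree_const])
  moreover have "const (1 / of_nat (Suc l)) * (const (of_nat (Suc l)) * z) = z" for z :: "'g halg"
  proof -
    have "const (1 / of_nat (Suc l)) * (const (of_nat (Suc l)) * z)
        = const (1 / of_nat (Suc l) * of_nat (Suc l)) * z"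
      by (simp only: const_mult mult.assoc)
    then show ?thesis by (simp del: of_nat_Suc)
  qed
  ultimately show ?case by (simp only:)
qed

lemma qpow_add:
  assumes "a * b \<doteq> b * a" "a \<in> carrier (hfree X)" "b \<in> carrier (hfree X)"
  shows "qpow (a + b) \<doteq> qpow a * qpow b"
  unfolding qpow_hsum hsum_mult using assms by (intro eqv_hsum exp_term_add)

lemma eqv_iff_coset:
  "a \<in> carrier (hfree X) \<Longrightarrow> b \<in> carrier (hfree X) \<Longrightarrow>
     a \<doteq> b \<longleftrightarrow> I +>\<^bsub>hfree X\<^esub> a = I +>\<^bsub>hfree X\<^esub> b"
  using I.quotient_eq_iff_same_a_r_cos[OF ideal, of a b] by (simp add: eqv_def a_minus_hfree)

end

section \<open>Bicommutants\<close>

context closed_ideal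
begin

text \<open>
  When \<open>G\<close> is commutative modulo the ideal, so is its bicommutant; the latter also contains the power
  series in its elements, so all reorderings of functions of the \<open>N\<^sub>i\<close> reduce to membership.
\<close>
definition bicommutant :: "'g halg set \<Rightarrow> 'g halg set" where
  "bicommutant G = {a \<in> carrier (hfree X). \<forall>x\<in>carrier (hfree X).
     (\<forall>g\<in>G. g * x \<doteq> x * g) \<longrightarrow> a * x \<doteq> x * a}"

lemma intertwine_add: "a * x \<doteq> x * a' \<Longrightarrow> b * x \<doteq> x * b' \<Longrightarrow> (a + b) * x \<doteq> x * (a' + b')"
  by (simp add: distrib_left distrib_right eqv_add)

lemma intertwine_uminus: "a * x \<doteq> x * a' \<Longrightarrow> - a * x \<doteq> x * - a'"
  by (simp add: eqv_uminus)

lemma intertwine_diff: "a * x \<doteq> x * a' \<Longrightarrow> b * x \<doteq> x * b' \<Longrightarrow> (a - b) * x \<doteq> x * (a' - b')"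
  by (simp add: left_diff_distrib right_diff_distrib eqv_diff)

lemma intertwine_mult:
  assumes "a * x \<doteq> x * a'" "b * x \<doteq> x * b'" "a \<in> carrier (hfree X)" "b' \<in> carrier (hfree X)"
  shows "a * b * x \<doteq> x * (a' * b')"
proof -
  have "a * (b * x) \<doteq> a * (x * b')"
    using assms by (intro eqv_mult_left)
  also have "a * (x * b') = a * x * b'" by (simp add: mult.assoc)
  also have "\<dots> \<doteq> x * a' * b'"
    using assms by (intro eqv_mult_right)
  finally show ?thesis by (simp add: mult.assoc)
qed

text \<open>Shifts compose along a product; this yields the effect of c_j^+ c_i^- from those of its
  factors.\<close>

lemma intertwine_trans:
  assumes "a * x \<doteq> x * b" "b * y \<doteq> y * c" "x \<in> carrier (hfree X)" "y \<in> carrier (hfree X)"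
  shows "a * (x * y) \<doteq> x * y * c"
proof -
  have "a * x * y \<doteq> x * b * y"
    using assms by (intro eqv_mult_right)
  also have "x * b * y = x * (b * y)" by (simp add: mult.assoc)
  also have "\<dots> \<doteq> x * (y * c)"
    using assms by (intro eqv_mult_left)
  finally show ?thesis by (simp add: mult.assoc)
qed

lemma intertwine_const: "x \<in> carrier (hfree X) \<Longrightarrow> const c * x \<doteq> x * const c"
  by (simp add: const_central eqv_refl hfree_closed)

lemma intertwine_1: "x \<in> carrier (hfree X) \<Longrightarrow> 1 * x \<doteq> x * 1"
  by (simp add: eqv_refl)

lemma bicommutant_carrier: "a \<in> bicommutant G \<Longrightarrow> a \<in> carrier (hfree X)"
  by (simp add: bicommutant_def)

lemma bicommutant_base: "G \<subseteq> carrier (hfree X) \<Longrightarrow> g \<in> G \<Longrightarrow> g \<in> bicommutant G"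
  by (auto simp: bicommutant_def)

lemma bicommutant_const: "const c \<in> bicommutant G"
  by (simp add: bicommutant_def hfree_const intertwine_const)

lemma bicommutant_1: "1 \<in> bicommutant G"
  using bicommutant_const[of 1] by simp

lemma bicommutant_add: "a \<in> bicommutant G \<Longrightarrow> b \<in> bicommutant G \<Longrightarrow> a + b \<in> bicommutant G"
  by (simp add: bicommutant_def hfree_add intertwine_add)

lemma bicommutant_uminus: "a \<in> bicommutant G \<Longrightarrow> - a \<in> bicommutant G"
  by (simp add: bicommutant_def hfree_uminus eqv_uminus)

lemma bicommutant_diff: "a \<in> bicommutant G \<Longrightarrow> b \<in> bicommutant G \<Longrightarrow> a - b \<in> bicommutant G"
  by (simp add: bicommutant_def hfree_diff intertwine_diff)

lemma bicommutant_mult: "a \<in> bicommutant G \<Longrightarrow> b \<in> bicommutant G \<Longrightarrow> a * b \<in> bicommutant G"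
  by (simp add: bicommutant_def hfree_mult intertwine_mult)

lemma bicommutant_sum: "(\<And>i. i \<in> A \<Longrightarrow> f i \<in> bicommutant G) \<Longrightarrow> (\<Sum>i\<in>A. f i) \<in> bicommutant G"
  using bicommutant_const[of 0 G]
  by (induction A rule: infinite_finite_induct) (auto intro: bicommutant_add)

lemma bicommutant_series_at: "a \<in> bicommutant G \<Longrightarrow> series_at F a \<in> bicommutant G"
  by (simp add: bicommutant_def hfree_series_at series_at_intertwine)

lemmas bicommutant_closed = bicommutant_const bicommutant_1 bicommutant_add bicommutant_uminus
  bicommutant_diff bicommutant_mult bicommutant_sum bicommutant_series_at

lemma bicommutant_commute:
  assumes "G \<subseteq> carrier (hfree X)" "\<And>g g'. g \<in> G \<Longrightarrow> g' \<in> G \<Longrightarrow> g * g' \<doteq> g' * g"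
    and "a \<in> bicommutant G" "b \<in> bicommutant G"
  shows "a * b \<doteq> b * a"
proof -
  \<comment> \<open>The definition is applied twice: \<open>g\<close> commutes with all of
    \<open>G\<close>, so \<open>b\<close> commutes with \<open>g\<close>; then \<open>b\<close> is a
    legitimate test element for \<open>a\<close>.\<close>
  have "g * b \<doteq> b * g" if "g \<in> G" for g
  proof -
    have "b * g \<doteq> g * b"
      using assms that by (auto simp: bicommutant_def subset_iff)
    then show ?thesis by (rule eqv_sym)
  qed
  with assms show ?thesis by (simp add: bicommutant_def)
qed

end

section \<open>Presented algebras and their homomorphisms\<close>

lemma closed_ideal_hideal:
  assumes "S \<subseteq> carrier (hfree X)"
  shows "closed_ideal X (hideal X S)"
proof (rule closed_ideal.intro)
  interpret R: ring "hfree X" by (rule ring_hfree)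
  \<comment> \<open>Closedness makes the carrier a member of the family of ideals to be intersected,
    which is therefore nonempty.\<close>
  have "closed (carrier (hfree X))"
    unfolding closed_def open_dist
  proof
    fix a :: "'a halg" assume "a \<in> - carrier (hfree X)"
    then obtain k where k: "\<not> (\<forall>w\<in>Poly_Mapping.keys (fps_nth a k). set (letters w) \<subseteq> X)"
      by (auto simp: hfree_def)
    \<comment> \<open>The k-th coefficient is locally constant in the h-adic metric, so a forbidden
      word in it survives in a whole ball.\<close>
    have "b \<in> - carrier (hfree X)" if "dist b a < inverse (2 ^ k)" for b
    proof -
      have "fps_nth b k = fps_nth a k"
        using that by (rule dist_less_imp_nth_equal) simp
      moreover have "\<forall>w\<in>Poly_Mapping.keys (fps_nth b k). set (letters w) \<subseteq> X"
        if "b \<in> carrier (hfree X)"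
        using that by (simp add: hfree_def)
      ultimately show ?thesis using k by auto
    qed
    then show "\<exists>e>0. \<forall>b. dist b a < e \<longrightarrow> b \<in> - carrier (hfree X)"
      by (intro exI[of _ "inverse (2 ^ k)"]) auto
  qed
  with assms have ne: "{I. ideal I (hfree X) \<and> closed I \<and> S \<subseteq> I} \<noteq> {}"
    using R.oneideal by blast
  show "ideal (hideal X S) (hfree X)"
    unfolding hideal_def by (rule R.i_Intersect[OF _ ne]) simp
  show "closed (hideal X S)"
    unfolding hideal_def by (rule closed_Inter) simp
qed

lemma subset_hideal: "S \<subseteq> hideal X S"
  by (auto simp: hideal_def)

lemma ring_halg: "S \<subseteq> carrier (hfree X) \<Longrightarrow> ring (halg X S)"
  unfolding halg_def by (intro ideal.quotient_is_ring closed_ideal.ideal closed_ideal_hideal)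

lemma hclass_ring_hom: "S \<subseteq> carrier (hfree X) \<Longrightarrow> hclass X S \<in> ring_hom (hfree X) (halg X S)"
  unfolding halg_def hclass_def[abs_def]
  by (intro ideal.rcos_ring_hom closed_ideal.ideal closed_ideal_hideal)

lemma halg_carrier_hclass: "z \<in> carrier (halg X S) \<Longrightarrow> \<exists>a\<in>carrier (hfree X). z = hclass X S a"
  by (auto simp: halg_def hclass_def FactRing_def A_RCOSETS_def')

lemma hclass_eq_iff:
  assumes "S \<subseteq> carrier (hfree X)" "a \<in> carrier (hfree X)" "b \<in> carrier (hfree X)"
  shows "hclass X S a = hclass X S b \<longleftrightarrow> closed_ideal.eqv X (hideal X S) a b"
  unfolding hclass_def using closed_ideal.eqv_iff_coset[OF closed_ideal_hideal] assms by blast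

lemma sbracket_hclass:
  assumes "S \<subseteq> carrier (hfree X)" "a \<in> carrier (hfree X)" "b \<in> carrier (hfree X)"
  shows "sbracket (halg X S) d d' (hclass X S a) (hclass X S b)
     = hclass X S (a * b - (-1) ^ (d * d') * b * a)"
  using sbracket_hom[OF ring_hfree ring_halg[OF assms(1)] hclass_ring_hom[OF assms(1)] assms(2,3), of d d'] assms
  by (simp add: sbracket_hfree)

text \<open>A \<complex>[[h]]-linear homomorphism fixes h^k, so it sends a remainder h^k t to a
  multiple of h^k. The image of F(a) thus agrees with F(b) modulo h^k and the ideal for every k, and
  closedness of the ideal finishes.\<close>

lemma halg_hom_series_at:
  fixes a :: "'a halg" and b :: "'b halg"
  assumes S: "S \<subseteq> carrier (hfree X)" and T: "T \<subseteq> carrier (hfree Y)"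
    and f: "f \<in> halg_hom X S Y T"
    and a: "a \<in> carrier (hfree X)" and b: "b \<in> carrier (hfree Y)"
    and ab: "f (hclass X S a) = hclass Y T b"
  shows "f (hclass X S (series_at F a)) = hclass Y T (series_at F b)"
proof -
  interpret W: closed_ideal Y "hideal Y T" by (rule closed_ideal_hideal[OF T])
  note hS = hclass_ring_hom[OF S] and hT = hclass_ring_hom[OF T]
  from f have fr: "f \<in> ring_hom (halg X S) (halg Y T)"
    and fs: "f (hclass X S (scal s)) = hclass Y T (scal s)" for s
    by (auto simp: halg_hom_def)
  \<comment> \<open>As a relation between representatives this avoids choosing a lift of
    \<open>f\<close> to the free algebras.\<close>
  define rel where "rel u v \<longleftrightarrow> u \<in> carrier (hfree X) \<and> v \<in> carrier (hfree Y)
      \<and> f (hclass X S u) = hclass Y T v" for u v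
  have rel_add: "rel (u + u') (v + v')" if "rel u v" "rel u' v'" for u u' v v'
    using that ring_hom_add[OF hS, of u u'] ring_hom_add[OF hT, of v v']
      ring_hom_add[OF fr, of "hclass X S u" "hclass X S u'"] ring_hom_closed[OF hS]
    by (simp add: rel_def hfree_add)
  have rel_mult: "rel (u * u') (v * v')" if "rel u v" "rel u' v'" for u u' v v'
    using that ring_hom_mult[OF hS, of u u'] ring_hom_mult[OF hT, of v v']
      ring_hom_mult[OF fr, of "hclass X S u" "hclass X S u'"] ring_hom_closed[OF hS]
    by (simp add: rel_def hfree_mult)
  have rel_scal: "rel (scal s) (scal s)" for s
    by (simp add: rel_def hfree_scal fs)
  have rel_poly: "rel (poly_at P a) (poly_at P b)" for P
  proof (induction P)
    case 0
    then show ?case using rel_scal[of 0] by simp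
  next
    case (pCons c P)
    have "rel a b" using a b ab by (simp add: rel_def)
    then show ?case
      unfolding poly_at_pCons const_def by (intro rel_add rel_mult rel_scal pCons)
  qed
  have rel_X: "rel (fps_X ^ k) (fps_X ^ k)" for k
    using rel_scal[of "fps_X ^ k"] by (simp add: scal_power scal_X)
  have rel_sum: "rel (\<Sum>i<k. fps_X ^ i * poly_at (P i) a) (\<Sum>i<k. fps_X ^ i * poly_at (P i) b)" for k P
  proof (induction k)
    case 0
    then show ?case using rel_scal[of 0] by simp
  next
    case (Suc k)
    then show ?case by (auto intro!: rel_add rel_mult rel_X rel_poly)
  qed
  have rel_ex: "\<exists>v. rel u v" if "u \<in> carrier (hfree X)" for u
  proof -
    have "f (hclass X S u) \<in> carrier (halg Y T)"
      using that ring_hom_closed[OF hS] ring_hom_closed[OF fr] by blast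
    with that show ?thesis using halg_carrier_hclass unfolding rel_def by blast
  qed
  have rel_unique: "v - v' \<in> hideal Y T" if "rel u v" "rel u v'" for u v v'
    using that hclass_eq_iff[OF T, of v v'] by (auto simp: rel_def W.eqv_def)
  have "series_at F a \<in> carrier (hfree X)" using a by (rule hfree_series_at)
  then obtain w where w: "rel (series_at F a) w" using rel_ex by blast
  have "w - series_at F b \<in> hideal Y T"
  proof (rule W.in_I_limit)
    fix k
    let ?tb = "hsum (\<lambda>i. poly_at (fps_nth F (i + k)) b)"
    have "hsum (\<lambda>i. poly_at (fps_nth F (i + k)) a) \<in> carrier (hfree X)"
      using a by (intro hfree_hsum hfree_poly_at)
    \<comment> \<open>Nothing is known about the image of the remainder except that it has some
      representative; the factor h^k in front makes that enough.\<close>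
    then obtain t where t: "rel (hsum (\<lambda>i. poly_at (fps_nth F (i + k)) a)) t" using rel_ex by blast
    have "rel (series_at F a) ((\<Sum>i<k. fps_X ^ i * poly_at (fps_nth F i) b) + fps_X ^ k * t)"
      unfolding series_at_hsum by (subst hsum_split[of _ k]) (intro rel_add rel_mult rel_sum rel_X t)
    then have "w - ((\<Sum>i<k. fps_X ^ i * poly_at (fps_nth F i) b) + fps_X ^ k * t) \<in> hideal Y T"
      by (rule rel_unique[OF w])
    also have "w - ((\<Sum>i<k. fps_X ^ i * poly_at (fps_nth F i) b) + fps_X ^ k * t)
        = w - series_at F b - fps_X ^ k * (t - ?tb)"
      unfolding series_at_hsum by (subst hsum_split[of _ k]) (simp add: right_diff_distrib)
    finally have "w - series_at F b - fps_X ^ k * (t - ?tb) \<in> hideal Y T" .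
    moreover have "t - ?tb \<in> carrier (hfree Y)"
      using t b by (intro hfree_diff hfree_hsum hfree_poly_at) (auto simp: rel_def)
    ultimately show "\<exists>c\<in>carrier (hfree Y). w - series_at F b - fps_X ^ k * c \<in> hideal Y T"
      by blast
  qed
  then show ?thesis
    using w b hclass_eq_iff[OF T, of w "series_at F b"] by (auto simp: rel_def W.eqv_def hfree_series_at)
qed

section \<open>Relators lie in the free algebras\<close>

lemma U_rels_carrier: "U_rels n m \<subseteq> carrier (hfree (U_gens n m))"
proof -
  have g: "gen (ChH i) \<in> carrier (hfree (U_gens n m))" "gen (ChE i) \<in> carrier (hfree (U_gens n m))"
     "gen (ChF i) \<in> carrier (hfree (U_gens n m))" if "i \<in> {1..n+m}" for i
    using that by (auto intro!: hfree_gen simp: U_gens_def)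
  have sb: "sbracket (hfree Y) d d' a b \<in> carrier (hfree Y)"
    if "a \<in> carrier (hfree Y)" "b \<in> carrier (hfree Y)" for a b :: "chevalley halg" and Y d d'
    using that by (subst sbracket_hfree) (auto intro!: hfree_closed)
  have qc: "qcomm s a b \<in> carrier (hfree Y)"
    if "a \<in> carrier (hfree Y)" "b \<in> carrier (hfree Y)" for a b :: "chevalley halg" and Y s
    using that unfolding qcomm_def by (auto intro!: hfree_closed)
  show ?thesis
    unfolding U_rels_def Let_def
    by (auto intro!: sb qc g hfree_diff hfree_add hfree_mult hfree_zero hfree_of_int hfree_series_at split: if_splits)
qed

lemma W_rels_carrier: "W_rels n m \<subseteq> carrier (hfree (W_gens n m))"
proof -
  have g: "cm i \<in> carrier (hfree (W_gens n m))" "cp i \<in> carrier (hfree (W_gens n m))"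
    if "i \<in> {1..n+m}" for i
    using that by (auto intro!: hfree_gen simp: W_gens_def)
  have sb: "sbracket (hfree Y) d d' a b \<in> carrier (hfree Y)"
    if "a \<in> carrier (hfree Y)" "b \<in> carrier (hfree Y)" for a b :: "oscillator halg" and Y d d'
    using that by (subst sbracket_hfree) (auto intro!: hfree_closed)
  show ?thesis
    unfolding W_rels_def Let_def
    by (auto intro!: sb g hfree_diff hfree_zero hfree_one split: if_splits)
qed

section \<open>The oscillator algebra\<close>

context closed_ideal
begin

lemma sign_mult_eqv:
  assumes "a \<doteq> (-1) ^ k * b"
  shows "(-1) ^ k * a \<doteq> b"
  using assms eqv_uminus[of a "- b"] by (cases "even k") simp_all

text \<open>The two signs multiply to 1. Applied to c_k^+ and c_k^- it shows that N_k commutes with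
  the oscillators of every other index, odd ones included.\<close>

lemma sign_commute_mult:
  assumes "a * x \<doteq> (-1) ^ k * x * a" "b * x \<doteq> (-1) ^ k * x * b"
    and "a \<in> carrier (hfree X)" "b \<in> carrier (hfree X)"
  shows "a * b * x \<doteq> x * (a * b)"
proof -
  have "a * (b * x) \<doteq> a * ((-1) ^ k * x * b)"
    using assms by (intro eqv_mult_left)
  also have "\<dots> = (-1) ^ k * (a * x * b)"
    by (cases "even k") (simp_all add: mult.assoc)
  also have "\<dots> \<doteq> (-1) ^ k * ((-1) ^ k * x * a * b)"
    using assms by (intro eqv_mult_left eqv_mult_right hfree_closed)
  also have "\<dots> = x * (a * b)"
    by (cases "even k") (simp_all add: mult.assoc)
  finally show ?thesis by (simp add: mult.assoc)
qed

end

locale oscillator_algebra = closed_ideal "W_gens n m" "hideal (W_gens n m) (W_rels n m)"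
  for n m :: nat
begin

notation eqv (infix "\<doteq>" 50)

abbreviation C :: "oscillator halg set" where "C \<equiv> carrier (hfree (W_gens n m))"

lemma clW_eq_iff: "a \<in> C \<Longrightarrow> b \<in> C \<Longrightarrow> clW n m a = clW n m b \<longleftrightarrow> a \<doteq> b"
  by (rule hclass_eq_iff[OF W_rels_carrier])

section \<open>Oscillator relations and shifts of the number operators\<close>

lemma cm_carrier: "i \<in> {1..n+m} \<Longrightarrow> cm i \<in> C"
  and cp_carrier: "i \<in> {1..n+m} \<Longrightarrow> cp i \<in> C"
  by (auto intro!: hfree_gen simp: W_gens_def)

lemma Nop_carrier: "i \<in> {1..n+m} \<Longrightarrow> Nop i \<in> C"
  by (simp add: Nop_def hfree_mult cm_carrier cp_carrier)

lemma W_rel_eqv: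
  assumes "r \<in> W_rels n m" "a \<in> C" "b \<in> C" "r = a - b"
  shows "a \<doteq> b"
  using assms subset_hideal[of "W_rels n m" "W_gens n m"] by (auto simp: eqv_def)

lemma cm_cp:
  assumes i: "i \<in> {1..n+m}" and j: "j \<in> {1..n+m}"
  shows "cm i * cp j \<doteq> (-1) ^ (theta n i * theta n j) * cp j * cm i + (if i = j then 1 else 0)"
proof (rule W_rel_eqv)
  show "sbracket (hfree (W_gens n m)) (theta n i) (theta n j) (cm i) (cp j) - (if i = j then 1 else 0)
      \<in> W_rels n m"
    unfolding W_rels_def Let_def using i j by blast
qed (use i j in \<open>auto simp: sbracket_hfree cm_carrier cp_carrier intro!: hfree_closed cm_carrier cp_carrier\<close>)

lemma cp_cp:
  assumes i: "i \<in> {1..n+m}" and j: "j \<in> {1..n+m}"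
  shows "cp i * cp j \<doteq> (-1) ^ (theta n i * theta n j) * cp j * cp i"
proof (rule W_rel_eqv)
  show "sbracket (hfree (W_gens n m)) (theta n i) (theta n j) (cp i) (cp j) \<in> W_rels n m"
    unfolding W_rels_def Let_def using i j by blast
qed (use i j in \<open>auto simp: sbracket_hfree cm_carrier cp_carrier intro!: hfree_closed cm_carrier cp_carrier\<close>)

lemma cm_cm:
  assumes i: "i \<in> {1..n+m}" and j: "j \<in> {1..n+m}"
  shows "cm i * cm j \<doteq> (-1) ^ (theta n i * theta n j) * cm j * cm i"
proof (rule W_rel_eqv)
  show "sbracket (hfree (W_gens n m)) (theta n i) (theta n j) (cm i) (cm j) \<in> W_rels n m"
    unfolding W_rels_def Let_def using i j by blast
qed (use i j in \<open>auto simp: sbracket_hfree cm_carrier cp_carrier intro!: hfree_closed cm_carrier cp_carrier\<close>)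

lemma Nop_cm:
  assumes k: "k \<in> {1..n+m}" and i: "i \<in> {1..n+m}"
  shows "Nop k * cm i \<doteq> cm i * (Nop k - (if k = i then 1 else 0))"
proof (cases "k = i")
  case False
  have "cp k * cm i \<doteq> (-1) ^ (theta n k * theta n i) * cm i * cp k"
  proof -
    have "cm i * cp k \<doteq> (-1) ^ (theta n i * theta n k) * (cp k * cm i)"
      using cm_cp[OF i k] False by (simp add: mult.assoc)
    from eqv_sym[OF sign_mult_eqv[OF this]] show ?thesis
      by (simp only: mult.assoc mult.commute[of "theta n k"])
  qed
  then have "Nop k * cm i \<doteq> cm i * Nop k"
    unfolding Nop_def
    by (rule sign_commute_mult) (use k i in \<open>auto intro: cm_cm cp_carrier cm_carrier\<close>)
  with False show ?thesis by simp
next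
  case True
  \<comment> \<open>For odd i this sign is -1, but then \<open>cm_cm\<close> makes the square of
    \<open>cm i\<close> congruent to its negative and absorbs the sign. Bosons and fermions need no
    separate treatment.\<close>
  let ?s = "(-1) ^ (theta n i * theta n i) :: oscillator halg"
  have "cm i * cp i * cm i \<doteq> (?s * cp i * cm i + 1) * cm i"
    using cm_cp[OF i i] i by (intro eqv_mult_right cm_carrier) simp_all
  also have "\<dots> = cp i * (?s * cm i * cm i) + cm i"
    by (cases "even (theta n i * theta n i)") (simp_all add: distrib_right left_diff_distrib mult.assoc)
  also have "\<dots> \<doteq> cp i * (cm i * cm i) + cm i"
    using i by (intro eqv_add eqv_mult_left eqv_refl cm_carrier cp_carrier eqv_sym[OF cm_cm])
  finally have "cm i * cp i * cm i - cm i \<doteq> cp i * (cm i * cm i) + cm i - cm i"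
    using i by (intro eqv_diff eqv_refl cm_carrier)
  then show ?thesis
    using True by (simp add: Nop_def eqv_sym mult.assoc right_diff_distrib)
qed

lemma Nop_cp:
  assumes k: "k \<in> {1..n+m}" and i: "i \<in> {1..n+m}"
  shows "Nop k * cp i \<doteq> cp i * (Nop k + (if k = i then 1 else 0))"
proof (cases "k = i")
  case False
  have "cm k * cp i \<doteq> (-1) ^ (theta n k * theta n i) * cp i * cm k"
    using cm_cp[OF k i] False by simp
  then have "Nop k * cp i \<doteq> cp i * Nop k"
    unfolding Nop_def
    by (intro sign_commute_mult[OF cp_cp]) (use k i in \<open>auto intro: cp_carrier cm_carrier\<close>)
  with False show ?thesis by simp
next
  case True
  let ?s = "(-1) ^ (theta n i * theta n i) :: oscillator halg"
  have "cp i * (cm i * cp i) \<doteq> cp i * (?s * cp i * cm i + 1)"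
    using cm_cp[OF i i] i by (intro eqv_mult_left cp_carrier) simp_all
  also have "\<dots> = ?s * cp i * cp i * cm i + cp i"
    by (cases "even (theta n i * theta n i)") (simp_all add: distrib_left right_diff_distrib mult.assoc)
  also have "\<dots> \<doteq> cp i * cp i * cm i + cp i"
    using i by (intro eqv_add eqv_mult_right eqv_refl cm_carrier cp_carrier eqv_sym[OF cp_cp])
  finally show ?thesis
    using True by (simp add: Nop_def mult.assoc distrib_left)
qed

text \<open>Passing c_l^+ and then c_l^- raises and lowers N_k by the same amount.\<close>

lemma Nop_commute:
  assumes "k \<in> {1..n+m}" "l \<in> {1..n+m}"
  shows "Nop k * Nop l \<doteq> Nop l * Nop k"
proof -
  have "(Nop k + (if k = l then 1 else 0)) * cm l
      \<doteq> cm l * (Nop k - (if k = l then 1 else 0) + (if k = l then 1 else 0))"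
    using assms by (intro intertwine_add Nop_cm) (auto intro!: eqv_refl hfree_zero cm_carrier)
  with Nop_cp[of k l] show ?thesis
    using assms unfolding Nop_def[of l] by (auto intro!: intertwine_trans cm_carrier cp_carrier)
qed

lemma sum_Nop_cm:
  assumes "finite A" "A \<subseteq> {1..n+m}" "i \<in> {1..n+m}"
  shows "(\<Sum>k\<in>A. Nop k) * cm i \<doteq> cm i * ((\<Sum>k\<in>A. Nop k) - (if i \<in> A then 1 else 0))"
proof -
  have "(\<Sum>k\<in>A. Nop k * cm i) \<doteq> (\<Sum>k\<in>A. cm i * (Nop k - (if k = i then 1 else 0)))"
    using assms by (intro eqv_sum Nop_cm) auto
  also have "\<dots> = cm i * ((\<Sum>k\<in>A. Nop k) - (\<Sum>k\<in>A. if k = i then 1 else 0))"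
    by (simp only: sum_distrib_left[symmetric] sum_subtractf)
  finally show ?thesis using assms(1) by (simp add: sum_distrib_right)
qed

lemma sum_Nop_cp:
  assumes "finite A" "A \<subseteq> {1..n+m}" "i \<in> {1..n+m}"
  shows "(\<Sum>k\<in>A. Nop k) * cp i \<doteq> cp i * ((\<Sum>k\<in>A. Nop k) + (if i \<in> A then 1 else 0))"
proof -
  have "(\<Sum>k\<in>A. Nop k * cp i) \<doteq> (\<Sum>k\<in>A. cp i * (Nop k + (if k = i then 1 else 0)))"
    using assms by (intro eqv_sum Nop_cp) auto
  also have "\<dots> = cp i * ((\<Sum>k\<in>A. Nop k) + (\<Sum>k\<in>A. if k = i then 1 else 0))"
    by (simp only: sum_distrib_left[symmetric] sum.distrib)
  finally show ?thesis using assms(1) by (simp add: sum_distrib_right)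
qed

text \<open>The diagonal elements: every factor of the Dyson images other than c_i^+ and c_i^- lies
  here.\<close>

definition D :: "oscillator halg set" where "D = bicommutant (Nop ` {1..n+m})"

lemma Nop_D: "i \<in> {1..n+m} \<Longrightarrow> Nop i \<in> D"
  unfolding D_def using Nop_carrier by (intro bicommutant_base) auto

lemma Ntot_D: "Ntot n m \<in> D"
  unfolding Ntot_def using Nop_D by (auto simp: D_def intro: bicommutant_sum)

lemmas D_closed = bicommutant_closed[where G = "Nop ` {1..n+m}", folded D_def]

lemma D_carrier: "a \<in> D \<Longrightarrow> a \<in> C"
  unfolding D_def by (rule bicommutant_carrier)

lemma D_commute: "a \<in> D \<Longrightarrow> b \<in> D \<Longrightarrow> a * b \<doteq> b * a"
  unfolding D_def
  by (rule bicommutant_commute[of "Nop ` {1..n+m}"])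
     (auto intro: Nop_carrier Nop_commute simp del: atLeastAtMost_iff)

lemma qpow_add_D: "a \<in> D \<Longrightarrow> b \<in> D \<Longrightarrow> qpow (a + b) \<doteq> qpow a * qpow b"
  by (intro qpow_add D_commute D_carrier)

end

section \<open>The Dyson realization\<close>

text \<open>q^(-a) is rewritten as another series at the same point \<open>a\<close>, so that
  knowing the image of H_j suffices for the inverse of L_j as well.\<close>

lemma qpow_uminus: "qpow (- a) = series_at (pexp (- [:0, 1:])) a"
  by (metis poly_at_X poly_at_uminus qpow_poly_at)

context closed_ideal
begin

text \<open>\<open>P * c\<close> plays a_i^- and \<open>V * d\<close> plays a_j^+, with
  \<open>V'\<close> and \<open>P'\<close> the diagonal factors that turn into \<open>V\<close> and
  \<open>P\<close> behind \<open>c\<close> and \<open>d\<close>. For i \<noteq> j there is no delta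
  term, so both products end in \<open>d * c\<close> and the sign factors out.\<close>

lemma superbracket_reorder:
  assumes cV: "V' * c \<doteq> c * V" and dP: "P' * d \<doteq> d * P" and cd: "c * d \<doteq> (-1) ^ k * d * c"
    and carrier: "V \<in> carrier (hfree X)" "V' \<in> carrier (hfree X)" "P \<in> carrier (hfree X)"
      "P' \<in> carrier (hfree X)" "c \<in> carrier (hfree X)" "d \<in> carrier (hfree X)"
  shows "P * c * (V * d) - (-1) ^ k * (V * d) * (P * c) \<doteq> (-1) ^ k * ((P * V' - V * P') * (d * c))"
proof -
  have "P * ((c * V) * d) \<doteq> P * ((V' * c) * d)"
    using carrier by (intro eqv_mult_left eqv_mult_right eqv_sym[OF cV])
  also have "\<dots> = P * V' * (c * d)" by (simp add: mult.assoc)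
  also have "\<dots> \<doteq> P * V' * ((-1) ^ k * d * c)"
    using carrier cd by (intro eqv_mult_left hfree_mult)
  finally have 1: "P * c * (V * d) \<doteq> P * V' * ((-1) ^ k * d * c)" by (simp add: mult.assoc)
  have "(-1) ^ k * V * ((d * P) * c) \<doteq> (-1) ^ k * V * ((P' * d) * c)"
    using carrier by (intro eqv_mult_left eqv_mult_right eqv_sym[OF dP] hfree_closed)
  then have 2: "(-1) ^ k * (V * d) * (P * c) \<doteq> (-1) ^ k * V * ((P' * d) * c)" by (simp add: mult.assoc)
  have "P * V' * ((-1) ^ k * d * c) - (-1) ^ k * V * ((P' * d) * c) = (-1) ^ k * ((P * V' - V * P') * (d * c))"
    by (cases "even k") (simp_all add: mult.assoc left_diff_distrib)
  with eqv_diff[OF 1 2] show ?thesis by simp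
qed

lemma intertwine_series_uminus:
  assumes "a * x \<doteq> x * b" "a \<in> carrier (hfree X)" "b \<in> carrier (hfree X)" "x \<in> carrier (hfree X)"
  shows "series_at F (- a) * x \<doteq> x * series_at F (- b)"
  using assms by (intro series_at_intertwine intertwine_uminus hfree_closed)

end

context oscillator_algebra
begin

text \<open>For j < i the creation operator shifts the prefix \<open>U\<close> of a_i^-, and the
  resulting \<open>q\<close> lands on the second product. For i < j, treated in
  \<open>D_shuffle_plus\<close>, the annihilation operator shifts the prefix \<open>V\<close> of
  a_j^+, and \<open>q\<close> lands on the first.\<close>

lemma D_shuffle_minus:
  assumes "U \<in> D" "V \<in> D" "f \<in> D" "b \<in> D" "b' \<in> D" "q \<in> D" "U' \<in> D"
    and U': "U' \<doteq> U * q" and g: "b - q * b' = - g"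
  shows "U * f * b * V - V * (U' * f * b') \<doteq> - (V * U * f * g)"
proof -
  note C = assms(1-7)[THEN D_carrier]
  have 1: "U * f * b * V \<doteq> V * (U * f * b)"
    using assms by (intro D_commute D_closed)
  have "V * (U' * f * b') \<doteq> V * (U * q * f * b')"
    using C by (intro eqv_mult_left eqv_mult_right U')
  also have "\<dots> = V * U * (q * f) * b'" by (simp add: mult.assoc)
  also have "\<dots> \<doteq> V * U * (f * q) * b'"
    using C assms(3,6) by (intro eqv_mult_left eqv_mult_right D_commute hfree_mult)
  finally have 2: "V * (U' * f * b') \<doteq> V * U * (f * q) * b'" .
  have "V * (U * f * b) - V * U * (f * q) * b' = V * U * f * (b - q * b')"
    by (simp add: mult.assoc right_diff_distrib)
  also have "\<dots> = - (V * U * f * g)" by (simp add: g)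
  finally show ?thesis using eqv_diff[OF 1 2] by simp
qed

lemma D_shuffle_plus:
  assumes "U \<in> D" "V \<in> D" "f \<in> D" "b \<in> D" "b' \<in> D" "q \<in> D" "V' \<in> D"
    and V': "V' \<doteq> V * q" and g: "q * b - b' = - g"
  shows "U * f * b * V' - V * (U * f * b') \<doteq> - (V * U * f * g)"
proof -
  note C = assms(1-7)[THEN D_carrier]
  have "U * f * b * V' \<doteq> U * f * b * (V * q)"
    using C by (intro eqv_mult_left V' hfree_mult)
  also have "\<dots> \<doteq> V * q * (U * f * b)"
    using assms by (intro D_commute D_closed)
  also have "\<dots> = V * (q * (U * f)) * b" by (simp add: mult.assoc)
  also have "\<dots> \<doteq> V * ((U * f) * q) * b"
    using C assms(1,3,6) by (intro eqv_mult_left eqv_mult_right D_commute D_closed)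
  finally have 1: "U * f * b * V' \<doteq> V * ((U * f) * q) * b" .
  have 2: "V * (U * f * b') \<doteq> V * (U * f * b')"
    using C by (intro eqv_refl hfree_mult)
  have "V * ((U * f) * q) * b - V * (U * f * b') = V * U * f * (q * b - b')"
    by (simp add: mult.assoc right_diff_distrib)
  also have "\<dots> = - (V * U * f * g)" by (simp add: g)
  finally show ?thesis using eqv_diff[OF 1 2] by simp
qed

section \<open>Superbrackets of the Dyson images\<close>

definition Nsum :: "nat \<Rightarrow> oscillator halg" where "Nsum i = (\<Sum>k\<in>{1..<i}. Nop k)"

lemma Nsum_D: "i \<in> {1..n+m} \<Longrightarrow> Nsum i \<in> D"
  unfolding Nsum_def by (intro D_closed Nop_D) auto

lemma Nsum_cm:
  assumes "i \<in> {1..n+m}" "l \<in> {1..n+m}"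
  shows "Nsum l * cm i \<doteq> cm i * (Nsum l - (if i < l then 1 else 0))"
  using sum_Nop_cm[of "{1..<l}" i] assms by (simp add: Nsum_def subset_iff)

lemma Nsum_cp:
  assumes "i \<in> {1..n+m}" "l \<in> {1..n+m}"
  shows "Nsum l * cp i \<doteq> cp i * (Nsum l + (if i < l then 1 else 0))"
  using sum_Nop_cp[of "{1..<l}" i] assms by (simp add: Nsum_def subset_iff)

lemma Ntot_cm: "i \<in> {1..n+m} \<Longrightarrow> Ntot n m * cm i \<doteq> cm i * (Ntot n m - 1)"
  using sum_Nop_cm[of "{1..n+m}" i] by (simp add: Ntot_def)

lemma Ntot_cp: "i \<in> {1..n+m} \<Longrightarrow> Ntot n m * cp i \<doteq> cp i * (Ntot n m + 1)"
  using sum_Nop_cp[of "{1..n+m}" i] by (simp add: Ntot_def)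

definition dyson_minus :: "complex \<Rightarrow> nat \<Rightarrow> oscillator halg" where
  "dyson_minus p i = qpow (Nsum i) * qbrk_ratio (Nop i + 1) * qbrk (const p - Ntot n m) * cm i"

definition dyson_plus :: "nat \<Rightarrow> oscillator halg" where
  "dyson_plus j = qpow (- Nsum j) * cp j"

definition dyson_H :: "complex \<Rightarrow> nat \<Rightarrow> oscillator halg" where
  "dyson_H p i = const p - (-1) ^ theta n i * Nop i - Ntot n m"

lemma dyson_H_D: "i \<in> {1..n+m} \<Longrightarrow> dyson_H p i \<in> D"
proof -
  assume i: "i \<in> {1..n+m}"
  have "(-1) ^ theta n i * Nop i \<in> D"
    using Nop_D[OF i] by (cases "even (theta n i)") (simp_all add: D_closed(4))
  then show ?thesis unfolding dyson_H_def by (intro D_closed(1,5) Ntot_D)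
qed

text \<open>Index j occurs in \<open>Nsum i\<close>, while i does not occur in
  \<open>Nsum j\<close>: c_j^+ shifts the prefix of a_i^- and the prefix of a_j^+ passes c_i^-
  unchanged.\<close>

lemma dyson_bracket_less:
  fixes p :: complex
  assumes i: "i \<in> {1..n+m}" and j: "j \<in> {1..n+m}" and "j < i"
  defines "y \<equiv> const p - Ntot n m"
  shows "dyson_minus p i * dyson_plus j - (-1) ^ (theta n i * theta n j) * dyson_plus j * dyson_minus p i
    \<doteq> (-1) ^ (theta n i * theta n j) *
        (- (qpow (- Nsum j) * qpow (Nsum i) * qbrk_ratio (Nop i + 1) * qpow (- y - 1)) * (cp j * cm i))"
proof -
  let ?c = "cm i" and ?d = "cp j" and ?S = "Nsum i" and ?T = "Nsum j" and ?f = "qbrk_ratio (Nop i + 1)"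
  note cC = cm_carrier[OF i] and dC = cp_carrier[OF j]
  have yD: "y \<in> D" unfolding y_def by (intro D_closed Ntot_D)
  note Ds = Nop_D[OF i] Nsum_D[OF i] Nsum_D[OF j] yD
  have 1: "qpow (- ?T) * ?c \<doteq> ?c * qpow (- ?T)"
    using Nsum_cm[OF i j] \<open>j < i\<close> cC D_carrier[OF Nsum_D[OF j]]
    by (intro intertwine_series_uminus) simp_all
  have d1: "1 * ?d \<doteq> ?d * 1" by (rule intertwine_1[OF dC])
  \<comment> \<open>The left side is chosen so that c_j^+, which raises \<open>?S\<close> by one,
    leaves exactly \<open>?S\<close> on the right; the same choice gives \<open>y + 1\<close>
    below.\<close>
  have "(?S - 1) * ?d \<doteq> ?d * (?S + 1 - 1)"
    using Nsum_cp[OF j i] \<open>j < i\<close> d1 by (intro intertwine_diff) simp_all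
  then have S: "qpow (?S - 1) * ?d \<doteq> ?d * qpow ?S"
    using Ds dC by (intro series_at_intertwine) (auto intro: D_carrier D_closed)
  have "(Nop i + 1) * ?d \<doteq> ?d * (Nop i + 1)"
    using Nop_cp[OF i j] \<open>j < i\<close> d1 by (intro intertwine_add) simp_all
  then have f: "?f * ?d \<doteq> ?d * ?f"
    using Ds dC by (intro series_at_intertwine) (auto intro: D_carrier D_closed)
  have "(const p - Ntot n m + 1) * ?d \<doteq> ?d * (const p - (Ntot n m + 1) + 1)"
    using Ntot_cp[OF j] intertwine_const[OF dC] d1 by (intro intertwine_diff intertwine_add)
  then have b: "qbrk (y + 1) * ?d \<doteq> ?d * qbrk y"
    using Ds dC by (intro series_at_intertwine) (auto simp: y_def intro: D_carrier D_closed)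
  have 2: "qpow (?S - 1) * ?f * qbrk (y + 1) * ?d \<doteq> ?d * (qpow ?S * ?f * qbrk y)"
    using Ds by (intro intertwine_mult S f b) (auto intro!: D_carrier D_closed)
  have 3: "?c * ?d \<doteq> (-1) ^ (theta n i * theta n j) * ?d * ?c"
    using cm_cp[OF i j] \<open>j < i\<close> by simp
  have "qpow (?S - 1) \<doteq> qpow ?S * qpow (-1)"
    using Ds qpow_add_D[of ?S "-1"] by (simp add: D_closed)
  note shuffle = D_shuffle_minus[OF _ _ _ _ _ _ _ this qbrk_minus_shift]
  have 4: "qpow ?S * ?f * qbrk y * qpow (- ?T) - qpow (- ?T) * (qpow (?S - 1) * ?f * qbrk (y + 1))
      \<doteq> - (qpow (- ?T) * qpow ?S * ?f * qpow (- y - 1))"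
    by (rule shuffle) (use Ds in \<open>auto intro!: D_closed\<close>)
  have "dyson_minus p i * dyson_plus j - (-1) ^ (theta n i * theta n j) * dyson_plus j * dyson_minus p i
    \<doteq> (-1) ^ (theta n i * theta n j) *
      ((qpow ?S * ?f * qbrk y * qpow (- ?T) - qpow (- ?T) * (qpow (?S - 1) * ?f * qbrk (y + 1))) * (?d * ?c))"
    unfolding dyson_minus_def dyson_plus_def y_def[symmetric]
    using Ds cC dC by (intro superbracket_reorder 1 2 3) (auto intro!: D_carrier D_closed)
  also have "\<dots> \<doteq> (-1) ^ (theta n i * theta n j) *
        (- (qpow (- ?T) * qpow ?S * ?f * qpow (- y - 1)) * (?d * ?c))"
    using cC dC by (intro eqv_mult_left eqv_mult_right 4 hfree_mult hfree_power hfree_uminus hfree_one)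
  finally show ?thesis .
qed

text \<open>Now i occurs in \<open>Nsum j\<close> and j does not occur in \<open>Nsum i\<close>, so
  the only shifted prefix is that of a_j^+, moved by c_i^-.\<close>

lemma dyson_bracket_greater:
  fixes p :: complex
  assumes i: "i \<in> {1..n+m}" and j: "j \<in> {1..n+m}" and "i < j"
  defines "y \<equiv> const p - Ntot n m"
  shows "dyson_minus p i * dyson_plus j - (-1) ^ (theta n i * theta n j) * dyson_plus j * dyson_minus p i
    \<doteq> (-1) ^ (theta n i * theta n j) *
        (- (qpow (- Nsum j) * qpow (Nsum i) * qbrk_ratio (Nop i + 1) * qpow y) * (cp j * cm i))"
proof -
  let ?c = "cm i" and ?d = "cp j" and ?S = "Nsum i" and ?T = "Nsum j" and ?f = "qbrk_ratio (Nop i + 1)"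
  note cC = cm_carrier[OF i] and dC = cp_carrier[OF j]
  have yD: "y \<in> D" unfolding y_def by (intro D_closed Ntot_D)
  note Ds = Nop_D[OF i] Nsum_D[OF i] Nsum_D[OF j] yD
  have d1: "1 * ?d \<doteq> ?d * 1" by (rule intertwine_1[OF dC])
  have "(- ?T - 1) * ?c \<doteq> ?c * (- (?T - 1) - 1)"
    using Nsum_cm[OF i j] \<open>i < j\<close> intertwine_1[OF cC] by (intro intertwine_diff intertwine_uminus) simp_all
  then have 1: "qpow (- ?T - 1) * ?c \<doteq> ?c * qpow (- ?T)"
    using Ds cC by (intro series_at_intertwine) (auto intro: D_carrier D_closed)
  have S: "qpow ?S * ?d \<doteq> ?d * qpow ?S"
    using Ds dC Nsum_cp[OF j i] \<open>i < j\<close> by (intro series_at_intertwine) (auto intro: D_carrier D_closed)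
  have "(Nop i + 1) * ?d \<doteq> ?d * (Nop i + 1)"
    using Nop_cp[OF i j] \<open>i < j\<close> d1 by (intro intertwine_add) simp_all
  then have f: "?f * ?d \<doteq> ?d * ?f"
    using Ds dC by (intro series_at_intertwine) (auto intro: D_carrier D_closed)
  have "(const p - Ntot n m + 1) * ?d \<doteq> ?d * (const p - (Ntot n m + 1) + 1)"
    using Ntot_cp[OF j] intertwine_const[OF dC] d1 by (intro intertwine_diff intertwine_add)
  then have b: "qbrk (y + 1) * ?d \<doteq> ?d * qbrk y"
    using Ds dC by (intro series_at_intertwine) (auto simp: y_def intro: D_carrier D_closed)
  have 2: "qpow ?S * ?f * qbrk (y + 1) * ?d \<doteq> ?d * (qpow ?S * ?f * qbrk y)"
    using Ds by (intro intertwine_mult S f b) (auto intro!: D_carrier D_closed)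
  have 3: "?c * ?d \<doteq> (-1) ^ (theta n i * theta n j) * ?d * ?c"
    using cm_cp[OF i j] \<open>i < j\<close> by simp
  have "qpow (- ?T - 1) \<doteq> qpow (- ?T) * qpow (-1)"
    using Ds qpow_add_D[of "- ?T" "-1"] by (simp add: D_closed)
  note shuffle = D_shuffle_plus[OF _ _ _ _ _ _ _ this shift_minus_qbrk]
  have 4: "qpow ?S * ?f * qbrk y * qpow (- ?T - 1) - qpow (- ?T) * (qpow ?S * ?f * qbrk (y + 1))
      \<doteq> - (qpow (- ?T) * qpow ?S * ?f * qpow y)"
    by (rule shuffle) (use Ds in \<open>auto intro!: D_closed\<close>)
  have "dyson_minus p i * dyson_plus j - (-1) ^ (theta n i * theta n j) * dyson_plus j * dyson_minus p i
    \<doteq> (-1) ^ (theta n i * theta n j) *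
      ((qpow ?S * ?f * qbrk y * qpow (- ?T - 1) - qpow (- ?T) * (qpow ?S * ?f * qbrk (y + 1))) * (?d * ?c))"
    unfolding dyson_minus_def dyson_plus_def y_def[symmetric]
    using Ds cC dC by (intro superbracket_reorder 1 2 3) (auto intro!: D_carrier D_closed)
  also have "\<dots> \<doteq> (-1) ^ (theta n i * theta n j) *
        (- (qpow (- ?T) * qpow ?S * ?f * qpow y) * (?d * ?c))"
    using cC dC by (intro eqv_mult_left eqv_mult_right 4 hfree_mult hfree_power hfree_uminus hfree_one)
  finally show ?thesis .
qed

end

section \<open>Solving for the root vectors\<close>

lemma (in closed_ideal) sign_cancel_eqv:
  assumes "(-1) ^ k * a \<doteq> (-1) ^ k * b"
  shows "a \<doteq> b"
  using assms eqv_uminus[of "- a" "- b"] by (cases "even k") simp_all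

context oscillator_algebra
begin

text \<open>The difference of the two prefixes is the origin of the sum over the intermediate
  indices in the final exponents.\<close>

lemma Nsum_split:
  assumes "j \<in> {1..n+m}" "j < i"
  shows "Nsum i = Nsum j + Nop j + (\<Sum>k\<in>{j<..<i}. Nop k)"
proof -
  have "{1..<i} = insert j ({1..<j} \<union> {j<..<i})"
    using assms by auto
  moreover have "{1..<j} \<inter> {j<..<i} = {}" by auto
  then have "(\<Sum>k\<in>{1..<j} \<union> {j<..<i}. Nop k) = (\<Sum>k\<in>{1..<j}. Nop k) + (\<Sum>k\<in>{j<..<i}. Nop k)"
    by (intro sum.union_disjoint) simp_all
  ultimately show ?thesis
    unfolding Nsum_def by (simp add: add_ac)
qed

text \<open>\<open>f\<close> is the factor [N_i+1]/(N_i+1), which the bracket leaves standing among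
  the powers of q.\<close>

lemma qpow_merge_D:
  assumes "a \<in> D" "b \<in> D" "c \<in> D" "d \<in> D" "f \<in> D"
  shows "qpow a * qpow b * f * qpow c * qpow d \<doteq> qpow (a + b + c + d) * f"
proof -
  have Q: "qpow x \<in> C" if "x \<in> D" for x
    using that by (intro D_carrier D_closed)
  have "qpow a * qpow b * (f * (qpow c * qpow d)) \<doteq> qpow a * qpow b * ((qpow c * qpow d) * f)"
    using assms by (intro eqv_mult_left D_commute hfree_mult Q D_closed)
  then have 1: "qpow a * qpow b * f * qpow c * qpow d \<doteq> qpow a * qpow b * qpow c * qpow d * f"
    by (simp add: mult.assoc)
  have "qpow (a + b + c + d) \<doteq> qpow (a + b + c) * qpow d"
    using assms by (intro qpow_add_D D_closed)
  also have "\<dots> \<doteq> (qpow (a + b) * qpow c) * qpow d"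
    using assms by (intro eqv_mult_right qpow_add_D D_closed Q)
  also have "\<dots> \<doteq> ((qpow a * qpow b) * qpow c) * qpow d"
    using assms by (intro eqv_mult_right qpow_add_D D_closed Q)
  finally have "qpow (a + b + c + d) * f \<doteq> qpow a * qpow b * qpow c * qpow d * f"
    using assms by (intro eqv_mult_right D_carrier)
  with 1 show ?thesis using eqv_sym eqv_trans by blast
qed

lemma qpow_inverse_D:
  assumes "a \<in> D"
  shows "qpow (- a) * qpow a \<doteq> 1" "qpow a * qpow (- a) \<doteq> 1"
  using qpow_add_D[of "- a" a] qpow_add_D[of a "- a"] assms
  by (simp_all add: D_closed qpow_0 eqv_sym)

text \<open>\<open>w\<close> is an unknown representative of the image of e_ji. It is isolated by
  multiplying with q^(H_j) on the right, and that factor must then be brought back across c_j^+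
  c_i^-.\<close>

lemma dyson_root_vector_less:
  assumes i: "i \<in> {1..n+m}" and j: "j \<in> {1..n+m}" and "j < i" and w: "w \<in> C"
    and eq: "dyson_minus p i * dyson_plus j - (-1) ^ (theta n i * theta n j) * dyson_plus j * dyson_minus p i
      \<doteq> (-1) ^ Suc (theta n j) * (w * qpow (- dyson_H p j))"
  shows "w \<doteq> qpow (of_nat (2 * theta n j) * (Nop j - 1) + (\<Sum>k\<in>{j<..<i}. Nop k))
      * qbrk_ratio (Nop i + 1) * cp j * cm i"
proof -
  let ?f = "qbrk_ratio (Nop i + 1)" and ?x = "cp j * cm i"
  define y where "y = const p - Ntot n m"
  define G where "G = qpow (- Nsum j) * qpow (Nsum i) * ?f * qpow (- y - 1)"
  \<comment> \<open>H_j with N_j lowered by one: the form it takes to the left of c_j^+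
    c_i^-.\<close>
  define H' where "H' = const p - (-1) ^ theta n j * (Nop j - 1) - Ntot n m"
  note cC = cm_carrier[OF i] and dC = cp_carrier[OF j]
  have yD: "y \<in> D" unfolding y_def by (intro D_closed Ntot_D)
  have N1: "Nop j - 1 \<in> D" using Nop_D[OF j] by (intro D_closed)
  then have H'D: "H' \<in> D"
    unfolding H'_def
    by (cases "even (theta n j)") (auto intro!: D_closed(1-5) Ntot_D Nop_D j)
  have fD: "?f \<in> D" using Nop_D[OF i] by (intro D_closed)
  have GD: "G \<in> D" unfolding G_def using yD Nsum_D[OF i] Nsum_D[OF j] Nop_D[OF i]
    by (intro D_closed)
  \<comment> \<open>If j is odd then so is the larger index i.\<close>
  have th: "theta n i * theta n j = theta n j"
    using \<open>j < i\<close> by (simp add: theta_def)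
  have "(-1) ^ Suc (theta n j) * (w * qpow (- dyson_H p j)) \<doteq> (-1) ^ Suc (theta n j) * (G * ?x)"
    using eqv_trans[OF eqv_sym[OF eq] dyson_bracket_less[OF i j \<open>j < i\<close>]]
    by (simp add: th G_def y_def)
  then have eq': "w * qpow (- dyson_H p j) \<doteq> G * ?x"
    by (rule sign_cancel_eqv)
  have "H' * (cp j * cm i) \<doteq> cp j * cm i * dyson_H p j"
  proof -
    \<comment> \<open>As a constant the sign intertwines with everything, whatever its
      value.\<close>
    define s :: "oscillator halg" where "s = const ((-1) ^ theta n j)"
    have s: "s = (-1) ^ theta n j" by (simp add: s_def const_power const_uminus)
    have 1: "(Nop j - 1) * ?x \<doteq> ?x * Nop j"
    proof (rule intertwine_trans[OF _ _ dC cC])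
      show "(Nop j - 1) * cp j \<doteq> cp j * (Nop j + 1 - 1)"
        using Nop_cp[OF j j] intertwine_1[OF dC] by (intro intertwine_diff) simp_all
      show "(Nop j + 1 - 1) * cm i \<doteq> cm i * Nop j"
        using Nop_cm[OF j i] \<open>j < i\<close> by simp
    qed
    \<comment> \<open>Creation at j and annihilation at i preserve the total number.\<close>
    have 2: "Ntot n m * ?x \<doteq> ?x * Ntot n m"
    proof (rule intertwine_trans[OF Ntot_cp[OF j] _ dC cC])
      show "(Ntot n m + 1) * cm i \<doteq> cm i * Ntot n m"
        using intertwine_add[OF Ntot_cm[OF i] intertwine_1[OF cC]] by simp
    qed
    have xC: "?x \<in> C" using cC dC by (rule hfree_mult[rotated])
    have "s * (Nop j - 1) * ?x \<doteq> ?x * (s * Nop j)"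
      using xC Nop_carrier[OF j] by (intro intertwine_mult 1) (simp_all add: s_def intertwine_const hfree_const)
    with 2 xC show ?thesis
      unfolding H'_def dyson_H_def s[symmetric] by (intro intertwine_diff intertwine_const)
  qed
  then have shift: "qpow H' * ?x \<doteq> ?x * qpow (dyson_H p j)"
    by (intro series_at_intertwine hfree_mult[OF dC cC] D_carrier[OF H'D] D_carrier[OF dyson_H_D[OF j]])
  have "w * 1 \<doteq> w * (qpow (- dyson_H p j) * qpow (dyson_H p j))"
    using w dyson_H_D[OF j] by (intro eqv_mult_left eqv_sym[OF qpow_inverse_D(1)])
  also have "\<dots> = w * qpow (- dyson_H p j) * qpow (dyson_H p j)" by (simp add: mult.assoc)
  also have "\<dots> \<doteq> G * ?x * qpow (dyson_H p j)"
    using dyson_H_D[OF j] by (intro eqv_mult_right eq' D_carrier D_closed)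
  also have "\<dots> = G * (?x * qpow (dyson_H p j))" by (simp add: mult.assoc)
  also have "\<dots> \<doteq> G * (qpow H' * ?x)"
    by (intro eqv_mult_left eqv_sym[OF shift] D_carrier GD)
  also have "\<dots> = G * qpow H' * ?x" by (simp add: mult.assoc)
  also have "\<dots> \<doteq> qpow (- Nsum j + Nsum i + (- y - 1) + H') * ?f * ?x"
    unfolding G_def using yD fD H'D Nsum_D[OF i] Nsum_D[OF j] cC dC
    by (intro eqv_mult_right qpow_merge_D hfree_mult) (auto intro: D_closed)
  \<comment> \<open>The prefixes leave N_j plus the middle sum, and the rest is -1 - (-1)^theta_j
    (N_j - 1) because p and N cancel; finally 1 - (-1)^theta_j = 2 theta_j.\<close>
  also have "- Nsum j + Nsum i + (- y - 1) + H'
      = of_nat (2 * theta n j) * (Nop j - 1) + (\<Sum>k\<in>{j<..<i}. Nop k)"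
    unfolding Nsum_split[OF j \<open>j < i\<close>] H'_def y_def by (simp add: theta_def algebra_simps mult_2)
  finally show ?thesis by (simp add: mult.assoc)
qed

text \<open>L_i stands to the left of e_ji, so its inverse only has to commute with diagonal factors
  and no shift of N_i arises.\<close>

lemma dyson_root_vector_greater:
  assumes i: "i \<in> {1..n+m}" and j: "j \<in> {1..n+m}" and "i < j" and w: "w \<in> C"
    and eq: "dyson_minus p i * dyson_plus j - (-1) ^ (theta n i * theta n j) * dyson_plus j * dyson_minus p i
      \<doteq> (-1) ^ Suc (theta n i) * (qpow (dyson_H p i) * w)"
  shows "w \<doteq> qpow (- (of_nat (2 * theta n i) * Nop i + (\<Sum>k\<in>{i<..<j}. Nop k)))
      * qbrk_ratio (Nop i + 1) * cp j * cm i"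
proof -
  let ?f = "qbrk_ratio (Nop i + 1)" and ?x = "cp j * cm i"
  define y where "y = const p - Ntot n m"
  define G where "G = qpow (- Nsum j) * qpow (Nsum i) * ?f * qpow y"
  note cC = cm_carrier[OF i] and dC = cp_carrier[OF j]
  have yD: "y \<in> D" unfolding y_def by (intro D_closed Ntot_D)
  have fD: "?f \<in> D" using Nop_D[OF i] by (intro D_closed)
  have GD: "G \<in> D" unfolding G_def using yD Nsum_D[OF i] Nsum_D[OF j] Nop_D[OF i]
    by (intro D_closed)
  have th: "theta n i * theta n j = theta n i"
    using \<open>i < j\<close> by (simp add: theta_def)
  have "(-1) ^ Suc (theta n i) * (qpow (dyson_H p i) * w) \<doteq> (-1) ^ Suc (theta n i) * (G * ?x)"
    using eqv_trans[OF eqv_sym[OF eq] dyson_bracket_greater[OF i j \<open>i < j\<close>]]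
    by (simp add: th G_def y_def)
  then have eq': "qpow (dyson_H p i) * w \<doteq> G * ?x"
    by (rule sign_cancel_eqv)
  have HD: "qpow (- dyson_H p i) \<in> D"
    using dyson_H_D[OF i] by (intro D_closed)
  have "1 * w \<doteq> qpow (- dyson_H p i) * qpow (dyson_H p i) * w"
    using w dyson_H_D[OF i] by (intro eqv_mult_right eqv_sym[OF qpow_inverse_D(1)])
  also have "\<dots> = qpow (- dyson_H p i) * (qpow (dyson_H p i) * w)" by (simp add: mult.assoc)
  also have "\<dots> \<doteq> qpow (- dyson_H p i) * (G * ?x)"
    by (intro eqv_mult_left eq' D_carrier HD)
  also have "\<dots> = qpow (- dyson_H p i) * G * ?x" by (simp add: mult.assoc)
  also have "\<dots> \<doteq> G * qpow (- dyson_H p i) * ?x"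
    using cC dC by (intro eqv_mult_right D_commute HD GD hfree_mult)
  also have "\<dots> \<doteq> qpow (- Nsum j + Nsum i + y + - dyson_H p i) * ?f * ?x"
    unfolding G_def using yD fD dyson_H_D[OF i] Nsum_D[OF i] Nsum_D[OF j] cC dC
    by (intro eqv_mult_right qpow_merge_D hfree_mult) (auto intro: D_closed)
  \<comment> \<open>The prefixes give -N_i and minus the middle sum; H_i contributes (-1)^theta_i
    N_i, which makes -2 theta_i N_i in total.\<close>
  also have "- Nsum j + Nsum i + y + - dyson_H p i
      = - (of_nat (2 * theta n i) * Nop i + (\<Sum>k\<in>{i<..<j}. Nop k))"
    unfolding Nsum_split[OF i \<open>i < j\<close>] dyson_H_def y_def by (simp add: theta_def algebra_simps mult_2)
  finally show ?thesis by (simp add: mult.assoc)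
qed

end

section \<open>Transfer along the homomorphism\<close>

lemma jac_carrier:
  assumes "i \<in> {1..n+m}"
  shows jacH_carrier: "jacH n i \<in> carrier (hfree (U_gens n m))"
    and jac_minus_carrier: "jac_minus n i \<in> carrier (hfree (U_gens n m))"
    and jac_plus_carrier: "jac_plus n i \<in> carrier (hfree (U_gens n m))"
proof -
  show "jacH n i \<in> carrier (hfree (U_gens n m))"
    unfolding jacH_def using assms
    by (intro hfree_sum hfree_mult hfree_power hfree_uminus hfree_one hfree_gen) (auto simp: U_gens_def)
  have gen_carrier: "gen (ChE k) \<in> carrier (hfree (U_gens n m))" "gen (ChF k) \<in> carrier (hfree (U_gens n m))"
    if "k \<in> {1..n+m}" for k n
    using that by (auto intro!: hfree_gen simp: U_gens_def)
  have qcomm_carrier: "qcomm s a b \<in> carrier (hfree (U_gens n m))"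
    if "a \<in> carrier (hfree (U_gens n m))" "b \<in> carrier (hfree (U_gens n m))" for s a b n
    using that unfolding qcomm_def
    by (intro hfree_diff hfree_mult hfree_series_at hfree_of_int)
  have "i \<in> {1..n+m} \<Longrightarrow> jac_minus n i \<in> carrier (hfree (U_gens n m))"
    by (induction n i rule: jac_minus.induct) (auto intro!: qcomm_carrier gen_carrier simp del: One_nat_def)
  with assms show "jac_minus n i \<in> carrier (hfree (U_gens n m))" by blast
  have "i \<in> {1..n+m} \<Longrightarrow> jac_plus n i \<in> carrier (hfree (U_gens n m))"
    by (induction n i rule: jac_plus.induct) (auto intro!: qcomm_carrier gen_carrier simp del: One_nat_def)
  with assms show "jac_plus n i \<in> carrier (hfree (U_gens n m))" by blast
qed

theorem mainTheorem6:
  fixes n m :: nat and p :: complex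
    and \<rho> :: "chevalley halg set \<Rightarrow> oscillator halg set"
    and e :: "nat \<Rightarrow> nat \<Rightarrow> chevalley halg set"
    and i j :: nat
  assumes "n + m \<ge> 1"
    and "dyson n m p \<rho>"
    and "cartan_weyl n m e"
    and "i \<in> {1..n+m}" and "j \<in> {1..n+m}"
  shows "(j < i \<longrightarrow> \<rho> (e j i) =
            clW n m (qpow (of_nat (2 * theta n j) * (Nop j - 1) + (\<Sum>k\<in>{j<..<i}. Nop k))
                       * qbrk_ratio (Nop i + 1) * cp j * cm i)) \<and>
         (i < j \<longrightarrow> \<rho> (e j i) =
            clW n m (qpow (- (of_nat (2 * theta n i) * Nop i + (\<Sum>k\<in>{i<..<j}. Nop k)))
                       * qbrk_ratio (Nop i + 1) * cp j * cm i))"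
proof -
  interpret W: oscillator_algebra n m
    unfolding oscillator_algebra_def by (rule closed_ideal_hideal[OF W_rels_carrier])
  note i = assms(4) and j = assms(5)
  let ?U = "Uq n m" and ?W = "halg (W_gens n m) (W_rels n m)"
  note ringU = ring_halg[OF U_rels_carrier[of n m]] and ringW = ring_halg[OF W_rels_carrier[of n m]]
  note homU = hclass_ring_hom[OF U_rels_carrier[of n m]] and homW = hclass_ring_hom[OF W_rels_carrier[of n m]]
  have \<rho>hom: "\<rho> \<in> halg_hom (U_gens n m) (U_rels n m) (W_gens n m) (W_rels n m)"
    using assms(2) by (simp add: dyson_def)
  then have \<rho>ring: "\<rho> \<in> ring_hom ?U ?W" by (simp add: halg_hom_def)
  have \<rho>H: "\<rho> (clU n m (jacH n k)) = clW n m (W.dyson_H p k)"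
    and \<rho>minus: "\<rho> (clU n m (jac_minus n k)) = clW n m (W.dyson_minus p k)"
    and \<rho>plus: "\<rho> (clU n m (jac_plus n k)) = clW n m (W.dyson_plus k)" if "k \<in> {1..n+m}" for k
    using assms(2) that
    by (auto simp: dyson_def W.dyson_H_def W.dyson_minus_def W.dyson_plus_def W.Nsum_def)
  have HC: "W.dyson_H p k \<in> W.C" if "k \<in> {1..n+m}" for k
    using that by (intro W.D_carrier W.dyson_H_D)
  have minusC: "W.dyson_minus p k \<in> W.C" and plusC: "W.dyson_plus k \<in> W.C" if "k \<in> {1..n+m}" for k
    unfolding W.dyson_minus_def W.dyson_plus_def using that
    by (intro hfree_mult W.D_carrier W.D_closed W.Nsum_D W.Nop_D W.Ntot_D W.cm_carrier W.cp_carrier; simp)+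
  have \<rho>series: "\<rho> (clU n m (series_at F (jacH n k))) = clW n m (series_at F (W.dyson_H p k))"
    if "k \<in> {1..n+m}" for F k
    using that by (intro halg_hom_series_at U_rels_carrier W_rels_carrier \<rho>hom jacH_carrier HC \<rho>H)
  have clU_closed: "clU n m a \<in> carrier ?U" if "a \<in> carrier (hfree (U_gens n m))" for a
    using that ring_hom_closed[OF homU] by blast
  show ?thesis
  proof (cases "i = j")
    case False
    then have e: "e j i \<in> carrier ?U"
      and bracket: "sbracket ?U (theta n i) (theta n j) (clU n m (jac_minus n i)) (clU n m (jac_plus n j)) =
          (if i < j
           then [(- ((-1 :: int) ^ theta n i))] \<cdot>\<^bsub>?U\<^esub> (clU n m (qpow (jacH n i)) \<otimes>\<^bsub>?U\<^esub> e j i)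
           else [(- ((-1 :: int) ^ theta n j))] \<cdot>\<^bsub>?U\<^esub> (e j i \<otimes>\<^bsub>?U\<^esub> clU n m (qpow (- jacH n j))))"
      using assms(3) i j unfolding cartan_weyl_def by blast+
    \<comment> \<open>The Cartan-Weyl relation determines e_ji only implicitly, so any
      representative of its image is taken and solved for.\<close>
    obtain w where w: "w \<in> W.C" and \<rho>e: "\<rho> (e j i) = clW n m w"
      using halg_carrier_hclass[OF ring_hom_closed[OF \<rho>ring e]] by blast
    define br where "br = W.dyson_minus p i * W.dyson_plus j
        - (-1) ^ (theta n i * theta n j) * W.dyson_plus j * W.dyson_minus p i"
    have brC: "br \<in> W.C"
      unfolding br_def using i j
      by (intro hfree_diff hfree_mult hfree_power hfree_uminus hfree_one minusC plusC)
    have \<rho>br: "\<rho> (sbracket ?U (theta n i) (theta n j) (clU n m (jac_minus n i)) (clU n m (jac_plus n j)))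
        = clW n m br"
      using i j
      by (simp add: sbracket_hom[OF ringU ringW \<rho>ring] clU_closed jac_minus_carrier jac_plus_carrier
          \<rho>minus \<rho>plus sbracket_hclass[OF W_rels_carrier] minusC plusC br_def del: atLeastAtMost_iff)
    \<comment> \<open>Used with \<open>k = Suc (theta n i)\<close> or
      \<open>k = Suc (theta n j)\<close>, which encodes the sign - (-1)^theta of the Cartan-Weyl
      relation as a pure power.\<close>
    have \<rho>sign: "\<rho> ([((-1 :: int) ^ k)] \<cdot>\<^bsub>?U\<^esub> (x \<otimes>\<^bsub>?U\<^esub> y)) = clW n m ((-1) ^ k * (a * b))"
      if "x \<in> carrier ?U" "y \<in> carrier ?U" "a \<in> W.C" "b \<in> W.C"
        "\<rho> x = clW n m a" "\<rho> y = clW n m b" for k x y a b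
    proof -
      have "x \<otimes>\<^bsub>?U\<^esub> y \<in> carrier ?U"
        using ring.ring_simprules(5)[OF ringU] that by blast
      then have "\<rho> ([((-1 :: int) ^ k)] \<cdot>\<^bsub>?U\<^esub> (x \<otimes>\<^bsub>?U\<^esub> y)) = [((-1 :: int) ^ k)] \<cdot>\<^bsub>?W\<^esub> (\<rho> x \<otimes>\<^bsub>?W\<^esub> \<rho> y)"
        using that by (simp add: add_pow_sign_hom[OF ringU ringW \<rho>ring] ring_hom_mult[OF \<rho>ring])
      also have "\<rho> x \<otimes>\<^bsub>?W\<^esub> \<rho> y = clW n m (a * b)"
        using that ring_hom_mult[OF homW, of a b] by simp
      also have "[((-1 :: int) ^ k)] \<cdot>\<^bsub>?W\<^esub> clW n m (a * b) = clW n m ((-1) ^ k * (a * b))"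
        using that add_pow_sign_hom[OF ring_hfree ringW homW, of "a * b" k]
        by (simp add: add_pow_sign_hfree hfree_mult)
      finally show ?thesis .
    qed
    have signC: "(-1) ^ k * a \<in> W.C" if "a \<in> W.C" for k a
      using that by (intro hfree_mult hfree_power hfree_uminus hfree_one)
    show ?thesis
    proof (cases "i < j")
      case True
      have "clW n m br = clW n m ((-1) ^ Suc (theta n i) * (qpow (W.dyson_H p i) * w))"
        using \<rho>br bracket True
          \<rho>sign[of "clU n m (qpow (jacH n i))" "e j i" "qpow (W.dyson_H p i)" w "Suc (theta n i)"]
          e w \<rho>e i \<rho>series[OF i]
        by (simp add: clU_closed hfree_series_at jacH_carrier HC del: atLeastAtMost_iff)
      then have "W.eqv br ((-1) ^ Suc (theta n i) * (qpow (W.dyson_H p i) * w))"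
        using W.clW_eq_iff brC signC hfree_mult hfree_series_at w HC[OF i] by metis
      from W.dyson_root_vector_greater[OF i j True w this[unfolded br_def]]
      have "clW n m w = clW n m (qpow (- (of_nat (2 * theta n i) * Nop i + (\<Sum>k\<in>{i<..<j}. Nop k)))
                       * qbrk_ratio (Nop i + 1) * cp j * cm i)"
        using W.clW_eq_iff W.eqv_carrier by blast
      then show ?thesis using True \<rho>e by simp
    next
      case False
      with \<open>i \<noteq> j\<close> have "j < i" by simp
      have "clW n m br = clW n m ((-1) ^ Suc (theta n j) * (w * qpow (- W.dyson_H p j)))"
        using \<rho>br bracket False
          \<rho>sign[of "e j i" "clU n m (qpow (- jacH n j))" w "qpow (- W.dyson_H p j)" "Suc (theta n j)"]
          e w \<rho>e j \<rho>series[OF j, of "pexp (- [:0, 1:])", folded qpow_uminus]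
        by (simp add: clU_closed hfree_series_at hfree_uminus jacH_carrier HC del: atLeastAtMost_iff)
      then have "W.eqv br ((-1) ^ Suc (theta n j) * (w * qpow (- W.dyson_H p j)))"
        using W.clW_eq_iff brC signC hfree_mult hfree_series_at hfree_uminus w HC[OF j] by metis
      from W.dyson_root_vector_less[OF i j \<open>j < i\<close> w this[unfolded br_def]]
      have "clW n m w = clW n m (qpow (of_nat (2 * theta n j) * (Nop j - 1) + (\<Sum>k\<in>{j<..<i}. Nop k))
                       * qbrk_ratio (Nop i + 1) * cp j * cm i)"
        using W.clW_eq_iff W.eqv_carrier by blast
      then show ?thesis using \<open>j < i\<close> \<rho>e by simp
    qed
  qed simp
qed

end
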